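(* Let $p$ be a prime and let $B\ge k\ge 1$ be integers such that $S(B,k)$ is a minimum zero case (MZC). Let $T\ge 0$ be an integer divisible by $p-1$ such that all powers of $p$ occurring (with nonzero coefficient) in the base $p$ expansion of $T$ are at least as big as all powers of $p$ occurring in the base $p$ expansion of $B$, and assume that $p\nmid\binom{T+B}{B}$ (i.e., the sum of the base $p$ coefficients of $T$ and $B$ for the exponent $\nu_p(T)$ is less than $p$). Then $S(T+B,k)$ is an almost minimum zero case (AMZC) and $$\nu_p(S(T+B,k))=\frac{\sigma_p(k)-\sigma_p(B)}{p-1}.$$
   Context: $S(n,k)$ is the Stirling number of the second kind; $\sigma_p(m)$ is the sum of the base $p$ digits of $m\ge 0$; $\nu_p$ is the $p$-adic valuation. $S(n,k)$ is a minimum zero case (MZC) if $\nu_p(S(n,k))=(\sigma_p(k)-\sigma_p(n))/(p-1)$. Higher order Bernoulli polynomials $B_m^{(l)}(x)$ ($m\ge 0$, $l\in\mathbb Z$) are defined by $\left(\frac{t}{e^t-1}\right)^l e^{tx}=\sum_{m\ge 0}B_m^{(l)}(x)\frac{t^m}{m!}$; $B_m^{(l)}(x)$ is monic of degree $m$ with rational coefficients, and $B_m^{(l)}=B_m^{(l)}(0)$. The maximum pole (with respect to $p$) of a nonzero rational polynomial is the integer $M$ such that $-M$ is the minimum of the $p$-adic valuations of its coefficients. For $n\ge k\ge 1$ and $M$ the maximum pole of $B_{n-k}^{(-k)}(x)$, $S(n,k)$ is an almost minimum zero case (AMZC) if $\nu_p(S(n,k))=\nu_p\left(\binom nk\right)-M$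 (equivalently $\nu_p(B_{n-k}^{(-k)})=-M$, since $S(n,k)=\binom nk B_{n-k}^{(-k)}$). *)

theory Defs
  imports
    "HOL-Computational_Algebra.Computational_Algebra"
    "HOL-Combinatorics.Stirling"
begin

definition digit :: "nat \<Rightarrow> nat \<Rightarrow> nat \<Rightarrow> nat" where
  "digit p m i = m div p ^ i mod p"

text \<open>For \<open>p \<ge> 2\<close> every digit in a position \<open>i > m\<close> vanishes, so this is the sum of all
  base \<open>p\<close> digits of \<open>m\<close>.\<close>

definition digit_sum :: "nat \<Rightarrow> nat \<Rightarrow> nat" where
  "digit_sum p m = (\<Sum>i\<le>m. digit p m i)"

text \<open>The \<open>p\<close>-adic valuation of a rational number. It extends \<^const>\<open>multiplicity\<close>
  on the natural numbers, and like it takes the junk value 0 (instead of infinity) at 0.\<close>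

definition padic_val :: "nat \<Rightarrow> rat \<Rightarrow> int" where
  "padic_val p x =
     int (multiplicity (int p) (fst (quotient_of x))) -
     int (multiplicity (int p) (snd (quotient_of x)))"

lemma multiplicity_int_int:
  "multiplicity (int p) (int n) = multiplicity p n"
  unfolding multiplicity_def by (simp flip: of_nat_power)

lemma padic_val_of_nat: "padic_val p (of_nat n) = int (multiplicity p n)"
  by (simp add: padic_val_def multiplicity_int_int)

text \<open>The series \<open>e\<^sup>t\<^sup>x\<close> in \<open>t\<close>, with coefficients in the polynomials in \<open>x\<close>.\<close>

definition exp_tx :: "rat poly fps" where
  "exp_tx = Abs_fps (\<lambda>n. monom (1 / fact n) n)"

definition bernoulli_series :: "int \<Rightarrow> rat fps" where
  "bernoulli_series l = (fps_X / (fps_exp 1 - 1)) powi l"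

text \<open>\<open>higher_bernoulli_poly l m\<close> is \<open>B\<^sub>m\<close> of order \<open>l\<close>: the factor \<open>fact m\<close> turns the
  coefficient of \<open>t\<^sup>m\<close> into that of \<open>t\<^sup>m / m!\<close>.\<close>

definition higher_bernoulli_poly :: "int \<Rightarrow> nat \<Rightarrow> rat poly" where
  "higher_bernoulli_poly l m =
     smult (fact m)
       (fps_nth (Abs_fps (\<lambda>n. [:fps_nth (bernoulli_series l) n:]) * exp_tx) m)"

text \<open>Zero coefficients have infinite valuation and so do not contribute to the minimum;
  they must be left out explicitly because of the junk value \<open>padic_val p 0 = 0\<close>.\<close>

definition max_pole :: "nat \<Rightarrow> rat poly \<Rightarrow> int" where
  "max_pole p f = - Min ((\<lambda>i. padic_val p (coeff f i)) ` {i. coeff f i \<noteq> 0})"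

text \<open>The condition \<open>Stirling n k \<noteq> 0\<close> rules out an infinite valuation on the left-hand side,
  which \<^const>\<open>multiplicity\<close> would represent by 0.\<close>

definition MZC :: "nat \<Rightarrow> nat \<Rightarrow> nat \<Rightarrow> bool" where
  "MZC p n k \<longleftrightarrow>
     Stirling n k \<noteq> 0 \<and>
     rat_of_nat (multiplicity p (Stirling n k)) =
       (rat_of_nat (digit_sum p k) - rat_of_nat (digit_sum p n)) / (rat_of_nat p - 1)"

definition AMZC :: "nat \<Rightarrow> nat \<Rightarrow> nat \<Rightarrow> bool" where
  "AMZC p n k \<longleftrightarrow>
     1 \<le> k \<and> k \<le> n \<and>
     int (multiplicity p (Stirling n k)) =
       int (multiplicity p (n choose k)) -
       max_pole p (higher_bernoulli_poly (- int k) (n - k))"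

end

theory Submission
  imports Defs
begin

text \<open>Put \<open>n = T + B\<close>. Up to a factor independent of \<open>e\<close>, the coefficient of \<open>x ^ e\<close> in
  \<open>B_{n-k}^{(-k)}(x)\<close> is \<open>(n choose e) k! S(n - e, k)\<close>, that is \<open>n!\<close> times the coefficient of
  \<open>t ^ n\<close> in \<open>t ^ e (e ^ t - 1) ^ k / e!\<close>. Lagrange inversion with \<open>z = e ^ t - 1\<close> turns it into a
  coefficient of a product with \<open>(ln (1 + z) / z) ^ (- n - 1)\<close>, which is expanded into monomials
  in the coefficients \<open>(- 1) ^ i / (i + 1)\<close>. By Legendre's formula the valuation of every monomial
  is expressed by digit sums, and comparing digit sums shows that it is at least
  \<open>(k - \<sigma>(B)) / (p - 1)\<close>. For \<open>e = 0\<close> equality holds only for the monomial that involves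
  \<open>i = p - 1\<close> alone. Applied to \<open>T = 0\<close>, this also shows that the minimum zero case for
  \<open>S(B, k)\<close> means that \<open>B\<close> and \<open>(B - k) / (p - 1)\<close> are added without carries.\<close>

section \<open>Lagrange inversion for Stirling numbers\<close>

text \<open>In units of \<open>1 / (p - 1)\<close> the contributions add up neatly.
  \<open>(n + j)!\<close> gives \<open>n + j - \<sigma> (n + j)\<close>, a monomial with
  \<open>j\<close> factors, weight \<open>w\<close> and cost \<open>Q\<close> gives at least
  \<open>Q - w - j\<close>, and the coefficient of degree \<open>w'\<close> in the remaining factor
  \<open>ln_weight e\<close> gives at least \<open>\<sigma> w' - w'\<close>. As
  \<open>n = w + w' + k\<close>, all that is left to show is
  \<open>\<sigma> (n + j) \<le> \<sigma> B + Q + \<sigma> w'\<close>. The index \<open>p - 1\<close>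
  is the only one whose factors cost nothing beyond the digit sum of their number. The obstacle is
  strictness for all other terms when \<open>e = 0\<close>. It helps that the remaining factor is
  then \<open>1 / (1 + z)\<close>, with coefficients \<open>1\<close> and \<open>- 1\<close>, so
  that leftover weight counts as \<open>w'\<close> and not only as \<open>\<sigma> w'\<close>. The
  minimum zero case enters through \<open>d = (B - k) / (p - 1)\<close>: if \<open>p ^ N\<close> is
  the leading power in \<open>B\<close>, absence of carries forces \<open>d < p ^ N\<close>, and
  \<open>T = (p - 1) * (p ^ N * t)\<close> then leaves the low digits alone.\<close>

lemma fps_nth_power_exp_minus_1:
  "fps_nth ((fps_exp (1::rat) - 1) ^ k) n = fact k * of_nat (Stirling n k) / fact n"
proof (induction n arbitrary: k)
  case 0
  show ?case by (cases k) simp_all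
next
  case (Suc n)
  show ?case
  proof (cases k)
    case 0
    then show ?thesis by simp
  next
    case (Suc l)
    define E where "E = fps_exp (1::rat) - 1"
    have "fps_deriv (E ^ k) = fps_const (of_nat k) * fps_deriv E * E ^ l"
      by (simp only: fps_deriv_power Suc diff_Suc_1)
    also have "fps_deriv E = E + 1" by (simp add: E_def)
    also have "fps_const (of_nat k) * (E + 1) * E ^ l = fps_const (of_nat k) * (E ^ k + E ^ l)"
      by (simp add: Suc algebra_simps)
    finally have "fps_nth (fps_deriv (E ^ k)) n = fps_nth (fps_const (of_nat k) * (E ^ k + E ^ l)) n"
      by (rule arg_cong)
    then have "of_nat (Suc n) * fps_nth (E ^ k) (Suc n)
        = of_nat k * (fps_nth (E ^ k) n + fps_nth (E ^ l) n)"
      by (simp only: fps_deriv_nth fps_mult_left_const_nth fps_add_nth Suc_eq_plus1)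
    also have "\<dots> = of_nat k * fact l * (of_nat k * of_nat (Stirling n k) + of_nat (Stirling n l)) / fact n"
      unfolding Suc.IH E_def by (simp add: Suc field_simps)
    also have "\<dots> = fact k * of_nat (Stirling (Suc n) k) / fact n"
      by (simp add: Suc field_simps)
    finally have "of_nat (Suc n) * fps_nth (E ^ k) (Suc n) * fact n = fact k * of_nat (Stirling (Suc n) k)"
      by (simp only: nonzero_eq_divide_eq fact_nonzero not_False_eq_True)
    then have "fps_nth (E ^ k) (Suc n) * fact (Suc n) = fact k * of_nat (Stirling (Suc n) k)"
      unfolding fact_Suc by (simp only: mult_ac)
    then show ?thesis
      unfolding E_def by (simp only: nonzero_eq_divide_eq fact_nonzero not_False_eq_True)
  qed
qed

text \<open>With \<open>f = fps_X * L\<close> this coefficient is the formal residue of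
  \<open>f ^ (m - n - 1)\<close> times the derivative of \<open>f\<close>, which is 0 for a
  derivative and 1 for \<open>m = n\<close>. Cancelling the powers of \<open>fps_X\<close> and
  \<open>L\<close> first avoids Laurent series.\<close>

lemma fps_nth_power_X_mult_lagrange:
  fixes L :: "'a::field_char_0 fps"
  assumes "fps_nth L 0 \<noteq> 0"
  shows "fps_nth ((fps_X * L) ^ m * (fps_deriv (fps_X * L) * inverse L ^ Suc n)) n
    = (if m = n then 1 else 0)"
proof (cases "m \<le> n")
  case False
  have eq: "(fps_X * L) ^ m * (fps_deriv (fps_X * L) * inverse L ^ Suc n)
      = fps_X ^ m * (L ^ m * fps_deriv (fps_X * L) * inverse L ^ Suc n)"
    by (simp only: power_mult_distrib mult.assoc)
  show ?thesis unfolding eq using False by (subst fps_X_power_mult_nth) simp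
next
  case True
  define a where "a = n - m"
  have n: "n = m + a" using True by (simp add: a_def)
  have inv: "L * inverse L = 1" using assms by (simp add: inverse_mult_eq_1')
  then have invm: "L ^ m * inverse L ^ m = 1" by (simp flip: power_mult_distrib)
  have "(fps_X * L) ^ m * (fps_deriv (fps_X * L) * inverse L ^ Suc n)
      = fps_X ^ m * ((L ^ m * inverse L ^ m) * (fps_deriv (fps_X * L) * inverse L ^ Suc a))"
    by (simp only: power_mult_distrib n power_add add_Suc_right[symmetric] mult_ac)
  also have "fps_deriv (fps_X * L) * inverse L ^ Suc a
      = (L * inverse L) * inverse L ^ a + fps_X * (fps_deriv L * inverse L ^ Suc a)"
    by (simp add: algebra_simps)
  finally have eq: "(fps_X * L) ^ m * (fps_deriv (fps_X * L) * inverse L ^ Suc n)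
      = fps_X ^ m * (inverse L ^ a + fps_X * (fps_deriv L * inverse L ^ Suc a))"
    by (simp add: inv invm)
  have "fps_nth (inverse L ^ a + fps_X * (fps_deriv L * inverse L ^ Suc a)) a
      = (if a = 0 then 1 else 0)"
  proof (cases a)
    case 0
    then show ?thesis by simp
  next
    case (Suc b)
    \<comment> \<open>Comparing the coefficients of the derivative shows that the two summands
      cancel in degree \<open>a\<close>; dividing by \<open>a\<close> is where characteristic 0 is
      used.\<close>
    have "fps_deriv (inverse L ^ a) = fps_const (of_nat a) * fps_deriv (inverse L) * inverse L ^ b"
      by (simp only: fps_deriv_power Suc diff_Suc_1)
    also have "\<dots> = - (fps_const (of_nat a) * (fps_deriv L * inverse L ^ Suc a))"
      unfolding fps_inverse_deriv[OF assms] by (simp add: Suc power2_eq_square mult_ac)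
    finally have "fps_deriv (inverse L ^ a) = - (fps_const (of_nat a) * (fps_deriv L * inverse L ^ Suc a))" .
    then have "fps_nth (fps_deriv (inverse L ^ a)) b
        = - (of_nat a * fps_nth (fps_deriv L * inverse L ^ Suc a) b)"
      by (simp only: fps_neg_nth fps_mult_left_const_nth)
    then have "of_nat a * fps_nth (inverse L ^ a) a
        = of_nat a * (- fps_nth (fps_deriv L * inverse L ^ Suc a) b)"
      by (simp add: Suc del: power_Suc)
    then have "fps_nth (inverse L ^ a) a = - fps_nth (fps_deriv L * inverse L ^ Suc a) b"
      using Suc by (simp only: mult_cancel_left of_nat_eq_0_iff) simp
    then show ?thesis by (simp add: Suc del: power_Suc)
  qed
  then show ?thesis unfolding eq by (simp add: fps_X_power_mult_nth n)
qed

text \<open>By linearity in \<open>H\<close>. Powers \<open>f ^ m\<close> with \<open>m > n\<close>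
  start beyond degree \<open>n\<close>, so the composition is a finite sum there and the two sums
  can be exchanged.\<close>

lemma fps_lagrange_inversion:
  fixes L H :: "'a::field_char_0 fps"
  assumes "fps_nth L 0 \<noteq> 0"
  shows "fps_nth ((H oo (fps_X * L)) * (fps_deriv (fps_X * L) * inverse L ^ Suc n)) n = fps_nth H n"
proof -
  define f K where "f = fps_X * L" and "K = fps_deriv f * inverse L ^ Suc n"
  have low: "fps_nth (f ^ m) i = 0" if "i < m" for m i
    using that by (simp add: f_def power_mult_distrib fps_X_power_mult_nth)
  have comp: "fps_nth (H oo f) i = (\<Sum>m=0..n. fps_nth H m * fps_nth (f ^ m) i)" if "i \<le> n" for i
    unfolding fps_compose_nth using that by (intro sum.mono_neutral_left) (auto simp: low)
  have "fps_nth ((H oo f) * K) n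
      = (\<Sum>i=0..n. \<Sum>m=0..n. fps_nth H m * (fps_nth (f ^ m) i * fps_nth K (n - i)))"
    unfolding fps_mult_nth by (intro sum.cong) (auto simp: comp sum_distrib_left sum_distrib_right mult_ac)
  also have "\<dots> = (\<Sum>m=0..n. fps_nth H m * fps_nth (f ^ m * K) n)"
    by (subst sum.swap) (simp add: fps_mult_nth sum_distrib_left)
  also have "\<dots> = (\<Sum>m=0..n. if m = n then fps_nth H m else 0)"
    using fps_nth_power_X_mult_lagrange[OF assms, of _ n]
    by (intro sum.cong) (auto simp: f_def K_def)
  also have "\<dots> = fps_nth H n" by simp
  finally show ?thesis by (simp add: f_def K_def)
qed

lemma fps_nth_inverse_power_one_minus:
  fixes Y :: "'a::field_char_0 fps"
  assumes "fps_nth Y 0 = 0"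
  shows "fps_nth (inverse (1 - Y) ^ Suc n) w = (\<Sum>j\<le>w. of_nat (n + j choose j) * fps_nth (Y ^ j) w)"
proof -
  define b :: "'a fps" where "b = Abs_fps (\<lambda>j. of_nat (n + j choose j))"
  have "b = inverse ((1 - fps_X) ^ Suc n)"
    using one_minus_const_fps_X_neg_power'[of "Suc n" "1::'a"] by (simp add: b_def del: power_Suc)
  then have "b * (1 - fps_X) ^ Suc n = 1"
    by (simp add: inverse_mult_eq_1)
  then have "(b * (1 - fps_X) ^ Suc n) oo Y = 1 oo Y" by simp
  then have "(b oo Y) * (1 - Y) ^ Suc n = 1"
    using assms by (simp add: fps_compose_mult_distrib fps_compose_power[symmetric] fps_compose_sub_distrib
        del: power_Suc)
  then have "inverse ((1 - Y) ^ Suc n) = b oo Y"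
    by (metis fps_inverse_unique mult.commute)
  then have "inverse (1 - Y) ^ Suc n = b oo Y" by (simp only: fps_inverse_power)
  then show ?thesis by (simp add: fps_compose_nth b_def atLeast0AtMost del: power_Suc)
qed

section \<open>Expansion of Stirling numbers in the coefficients of the logarithm\<close>

definition ln_quot :: "rat fps"
  where "ln_quot = Abs_fps (\<lambda>i. (- 1) ^ i / of_nat (Suc i))"

lemma fps_ln_eq_ln_quot: "fps_ln 1 = fps_X * ln_quot"
  by (rule fps_ext) (simp add: fps_ln_nth ln_quot_def)

lemma fps_exp_compose_ln: "(fps_exp (1::rat) - 1) oo fps_ln 1 = fps_X"
  using fps_inv_right[of "fps_exp (1::rat) - 1"] by (simp add: fps_ln_fps_exp_inv)

text \<open>What becomes of \<open>t ^ e / e!\<close> under \<open>t = ln (1 + z)\<close>, together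
  with the derivative of the substitution that Lagrange inversion brings in.\<close>

definition ln_weight :: "nat \<Rightarrow> rat fps"
  where "ln_weight e = fps_const (1 / fact e) * (fps_ln 1 ^ e * fps_deriv (fps_ln 1))"

text \<open>Under the substitution \<open>(exp t - 1) ^ k\<close> becomes \<open>z ^ k\<close>. The
  negative binomial series in \<open>1 - ln_quot\<close> produces \<open>n + j choose j\<close>, and
  multiplying by \<open>n!\<close> turns this into \<open>(n + j)! / j!\<close>. The factor
  \<open>1 / j!\<close> stays with the \<open>j\<close>-th power, making it a divided power.\<close>

lemma binomial_Stirling_expansion:
  assumes "e + k \<le> n"
  shows "of_nat (n choose e) * (fact k * of_nat (Stirling (n - e) k)) =
    (\<Sum>w\<le>n - k. fps_nth (ln_weight e) (n - k - w) *
      (\<Sum>j\<le>w. fact (n + j) * (fps_nth ((1 - ln_quot) ^ j) w / fact j)))"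
proof -
  let ?E = "fps_exp (1::rat) - 1"
  have "(fps_X ^ e * ?E ^ k) oo fps_ln 1 = fps_ln 1 ^ e * fps_X ^ k"
    by (simp add: fps_compose_mult_distrib fps_compose_power[symmetric] fps_exp_compose_ln
        fps_X_fps_compose_startby0)
  then have "fps_nth (fps_ln 1 ^ e * fps_X ^ k *
      (fps_deriv (fps_ln 1) * inverse ln_quot ^ Suc n)) n = fps_nth (fps_X ^ e * ?E ^ k) n"
    using fps_lagrange_inversion[of ln_quot "fps_X ^ e * ?E ^ k" n]
    unfolding fps_ln_eq_ln_quot[symmetric] by (simp add: ln_quot_def del: power_Suc)
  also have "\<dots> = fact k * of_nat (Stirling (n - e) k) / fact (n - e)"
    using assms by (simp add: fps_X_power_mult_nth fps_nth_power_exp_minus_1)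
  finally have "fact k * of_nat (Stirling (n - e) k) / fact (n - e) =
      fps_nth (fps_ln 1 ^ e * fps_X ^ k * (fps_deriv (fps_ln 1) * inverse ln_quot ^ Suc n)) n"
    by simp
  then have "fact k * of_nat (Stirling (n - e) k) / fact (n - e) / fact e
      = fps_nth (fps_const (1 / fact e) *
          (fps_ln 1 ^ e * fps_X ^ k * (fps_deriv (fps_ln 1) * inverse ln_quot ^ Suc n))) n"
    by simp
  also have "fps_const (1 / fact e) *
        (fps_ln 1 ^ e * fps_X ^ k * (fps_deriv (fps_ln 1) * inverse ln_quot ^ Suc n))
      = fps_X ^ k * (inverse ln_quot ^ Suc n * ln_weight e)"
    by (simp add: ln_weight_def mult_ac)
  also have "fps_nth \<dots> n = fps_nth (inverse ln_quot ^ Suc n * ln_weight e) (n - k)"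
    using assms by (subst fps_X_power_mult_nth) simp
  also have "inverse ln_quot ^ Suc n = inverse (1 - (1 - ln_quot)) ^ Suc n" by simp
  also have "fps_nth (inverse (1 - (1 - ln_quot)) ^ Suc n * ln_weight e) (n - k)
      = (\<Sum>w\<le>n - k. fps_nth (ln_weight e) (n - k - w) *
          (\<Sum>j\<le>w. of_nat (n + j choose j) * fps_nth ((1 - ln_quot) ^ j) w))"
    by (subst fps_mult_nth, subst fps_nth_inverse_power_one_minus)
      (simp_all add: ln_quot_def atLeast0AtMost mult.commute)
  finally have "fact n * (fact k * of_nat (Stirling (n - e) k) / fact (n - e) / fact e)
      = (\<Sum>w\<le>n - k. fps_nth (ln_weight e) (n - k - w) *
          (\<Sum>j\<le>w. fact n * of_nat (n + j choose j) * fps_nth ((1 - ln_quot) ^ j) w))"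
    by (simp add: sum_distrib_left mult_ac)
  moreover have "fact n * rat_of_nat (n + j choose j) = fact (n + j) / fact j" for j
    using binomial_fact[of j "n + j", where ?'a = rat] by simp
  moreover have "fact n * (fact k * of_nat (Stirling (n - e) k) / fact (n - e) / fact e)
      = rat_of_nat (n choose e) * (fact k * of_nat (Stirling (n - e) k))"
    using binomial_fact[of e n, where ?'a = rat] assms by simp
  ultimately show ?thesis by simp
qed

lemma ln_weight_deriv: "ln_weight e = fps_deriv (fps_const (1 / fact (Suc e)) * fps_ln 1 ^ Suc e)"
proof -
  have "fps_const (1 / fact (Suc e)) * fps_const (rat_of_nat (Suc e)) = fps_const (1 / fact e)"
    by (simp add: field_simps del: of_nat_Suc)
  then have "ln_weight e = fps_const (1 / fact (Suc e)) * fps_const (rat_of_nat (Suc e))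
      * (fps_ln 1 ^ e * fps_deriv (fps_ln 1))"
    by (simp only: ln_weight_def)
  then show ?thesis
    unfolding fps_deriv_mult_const_left fps_deriv_power diff_Suc_1 by (simp only: mult_ac)
qed

text \<open>These are the signed Stirling numbers of the first kind. Writing \<open>h e\<close> for
  the series, \<open>1 + z\<close> times the derivative of \<open>h (Suc e)\<close> is
  \<open>h e\<close>, which gives an integral recurrence.\<close>

lemma fps_nth_ln_power_int:
  "\<exists>a::int. fact w * fps_nth (fps_const (1 / fact e) * fps_ln (1::rat) ^ e) w = of_int a"
proof (induction w arbitrary: e)
  case 0
  show ?case by (cases e) (auto intro: exI[of _ 0] exI[of _ 1])
next
  case (Suc w)
  define h :: "nat \<Rightarrow> rat fps" where "h e = fps_const (1 / fact e) * fps_ln 1 ^ e" for e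
  show ?case
  proof (cases e)
    case 0
    then show ?thesis by (auto intro: exI[of _ 0])
  next
    case (Suc e')
    have "fps_deriv (h e) = h e' * inverse (1 + fps_X)"
    proof -
      have "fps_deriv (h e) = ln_weight e'" by (simp only: h_def Suc ln_weight_deriv)
      then show ?thesis by (simp add: ln_weight_def h_def fps_ln_deriv mult.assoc)
    qed
    then have "(1 + fps_X) * fps_deriv (h e) = h e' * ((1 + fps_X) * inverse (1 + fps_X))"
      by (simp add: mult_ac)
    also have "(1 + fps_X) * inverse (1 + fps_X :: rat fps) = 1"
      by (simp add: inverse_mult_eq_1')
    finally have "fps_nth ((1 + fps_X) * fps_deriv (h e)) w = fps_nth (h e') w" by simp
    moreover have "fps_nth ((1 + fps_X) * fps_deriv (h e)) w
        = of_nat (Suc w) * fps_nth (h e) (Suc w) + of_nat w * fps_nth (h e) w"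
      by (cases w) (simp_all add: distrib_right)
    ultimately have rec: "of_nat (Suc w) * fps_nth (h e) (Suc w)
        = fps_nth (h e') w - of_nat w * fps_nth (h e) w" by simp
    have "fact (Suc w) * fps_nth (h e) (Suc w) = fact w * (of_nat (Suc w) * fps_nth (h e) (Suc w))"
      by simp
    also have "\<dots> = fact w * fps_nth (h e') w - of_int (int w) * (fact w * fps_nth (h e) w)"
      unfolding rec by (simp add: algebra_simps)
    finally have eq: "fact (Suc w) * fps_nth (h e) (Suc w)
        = fact w * fps_nth (h e') w - of_int (int w) * (fact w * fps_nth (h e) w)" .
    obtain a b where "fact w * fps_nth (h e') w = of_int a" "fact w * fps_nth (h e) w = of_int b"
      using Suc.IH[of e'] Suc.IH[of e] unfolding h_def by auto
    then have "fact (Suc w) * fps_nth (h e) (Suc w) = of_int (a - int w * b)"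
      unfolding eq by simp
    then show ?thesis unfolding h_def by blast
  qed
qed

lemma fps_nth_ln_weight_int: "\<exists>a::int. fact w * fps_nth (ln_weight e) w = of_int a"
proof -
  have "fact w * fps_nth (ln_weight e) w
      = fact (Suc w) * fps_nth (fps_const (1 / fact (Suc e)) * fps_ln (1::rat) ^ Suc e) (Suc w)"
    unfolding ln_weight_deriv by (simp add: mult_ac del: power_Suc)
  then show ?thesis using fps_nth_ln_power_int[of "Suc w" "Suc e"] by metis
qed

lemma fps_nth_ln_weight_0: "fps_nth (ln_weight 0) w = (- 1) ^ w"
  by (simp add: ln_weight_def fps_ln_deriv fps_inverse_fps_X_plus1)

text \<open>The binomial theorem for divided powers: no binomial coefficient is left, only
  \<open>1 / fact u\<close> for each monomial, so that monomials can be split off one at a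
  time.\<close>

lemma fps_nth_power_add_monomial:
  fixes A :: "rat fps"
  shows "fps_nth ((fps_const c * fps_X ^ i + A) ^ j) w / fact j =
    (\<Sum>u\<le>j. if w < i * u then 0 else c ^ u / fact u * (fps_nth (A ^ (j - u)) (w - i * u) / fact (j - u)))"
proof -
  have "fps_nth ((fps_const c * fps_X ^ i + A) ^ j) w =
      (\<Sum>u\<le>j. fps_nth (of_nat (j choose u) * (fps_const c * fps_X ^ i) ^ u * A ^ (j - u)) w)"
    by (simp add: binomial_ring fps_sum_nth)
  also have "\<dots> = (\<Sum>u\<le>j. if w < i * u then 0
      else of_nat (j choose u) * c ^ u * fps_nth (A ^ (j - u)) (w - i * u))"
  proof (intro sum.cong refl)
    fix u
    have eq: "of_nat (j choose u) * (fps_const c * fps_X ^ i) ^ u * A ^ (j - u) =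
        fps_const (of_nat (j choose u) * c ^ u) * (fps_X ^ (i * u) * A ^ (j - u))"
      by (simp add: power_mult_distrib power_mult fps_of_nat[symmetric] fps_const_power
          flip: fps_const_mult)
    show "fps_nth (of_nat (j choose u) * (fps_const c * fps_X ^ i) ^ u * A ^ (j - u)) w =
        (if w < i * u then 0 else of_nat (j choose u) * c ^ u * fps_nth (A ^ (j - u)) (w - i * u))"
      unfolding eq fps_mult_left_const_nth fps_X_power_mult_nth by simp
  qed
  finally have eq: "fps_nth ((fps_const c * fps_X ^ i + A) ^ j) w = \<dots>" .
  show ?thesis
    unfolding eq sum_divide_distrib
    by (intro sum.cong refl) (auto simp: binomial_fact field_simps)
qed

lemma fps_nth_power_cong:
  "(\<And>i. i \<le> w \<Longrightarrow> fps_nth A i = fps_nth B i) \<Longrightarrow> fps_nth (A ^ j) w = fps_nth (B ^ j) w"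
proof (induction j arbitrary: w)
  case (Suc j)
  then show ?case by (simp add: fps_mult_nth)
qed simp

definition ln_coeff :: "nat \<Rightarrow> rat"
  where "ln_coeff i = - ((- 1) ^ i / of_nat (Suc i))"

definition ln_part :: "nat set \<Rightarrow> rat fps"
  where "ln_part I = (\<Sum>i\<in>I. fps_const (ln_coeff i) * fps_X ^ i)"

lemma ln_part_insert:
  "finite I \<Longrightarrow> i \<notin> I \<Longrightarrow> ln_part (insert i I) = fps_const (ln_coeff i) * fps_X ^ i + ln_part I"
  by (simp add: ln_part_def)

lemma fps_nth_ln_part: "finite I \<Longrightarrow> fps_nth (ln_part I) w = (if w \<in> I then ln_coeff w else 0)"
  by (simp add: ln_part_def fps_sum_nth if_distrib cong: if_cong)

text \<open>Degree \<open>w\<close> sees only indices up to \<open>w\<close>, and index 0 is absent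
  because \<open>ln_quot\<close> has constant term 1. A finite index set makes induction on the set
  possible.\<close>

lemma fps_nth_one_minus_ln_quot_power:
  assumes "w \<le> M"
  shows "fps_nth ((1 - ln_quot) ^ j) w = fps_nth (ln_part {1..M} ^ j) w"
  using assms
  by (intro fps_nth_power_cong) (auto simp: fps_nth_ln_part ln_quot_def ln_coeff_def not_less_eq_eq)

section \<open>Coefficients of the higher order Bernoulli polynomials\<close>

lemma fps_nth_bernoulli_series:
  assumes "1 \<le> k"
  shows "fps_nth (bernoulli_series (- int k)) s = fact k * of_nat (Stirling (s + k) k) / fact (s + k)"
proof -
  \<comment> \<open>\<open>G\<close> is \<open>(exp t - 1) / t\<close>, a unit; the base of the
    Bernoulli series is its inverse, so the exponent \<open>- k\<close> yields an ordinary power of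
    \<open>G\<close>.\<close>
  define G :: "rat fps" where "G = Abs_fps (\<lambda>n. 1 / fact (Suc n))"
  have G0: "fps_nth G 0 \<noteq> 0" by (simp add: G_def)
  have E: "fps_exp 1 - 1 = fps_X * G"
    by (rule fps_ext) (simp add: G_def del: fact_Suc)
  have "fps_X * G \<noteq> 0" using G0 by auto
  have "fps_X = inverse G * (fps_X * G)"
    using inverse_mult_eq_1[OF G0] by (simp add: mult_ac)
  then have "fps_X / (fps_X * G) = inverse G"
    using \<open>fps_X * G \<noteq> 0\<close> by (metis nonzero_mult_div_cancel_right)
  then have "bernoulli_series (- int k) = G ^ k"
    using assms G0 by (simp add: bernoulli_series_def E power_int_def fps_inverse_idempotent)
  then have "fps_nth (bernoulli_series (- int k)) s = fps_nth (fps_X ^ k * G ^ k) (s + k)"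
    by (simp add: fps_X_power_mult_nth)
  also have "fps_X ^ k * G ^ k = (fps_exp 1 - 1) ^ k" by (simp add: E power_mult_distrib)
  finally show ?thesis by (simp only: fps_nth_power_exp_minus_1)
qed

lemma coeff_higher_bernoulli_poly:
  "coeff (higher_bernoulli_poly l m) e =
    (if e \<le> m then fact m / fact e * fps_nth (bernoulli_series l) (m - e) else 0)"
proof -
  have "coeff (higher_bernoulli_poly l m) e =
      fact m * (\<Sum>i=0..m. fps_nth (bernoulli_series l) i * (if m - i = e then 1 / fact (m - i) else 0))"
    by (simp add: higher_bernoulli_poly_def exp_tx_def fps_mult_nth coeff_sum)
  also have "(\<Sum>i=0..m. fps_nth (bernoulli_series l) i * (if m - i = e then 1 / fact (m - i) else 0))
      = (\<Sum>i=0..m. if i = m - e then (if e \<le> m then fps_nth (bernoulli_series l) i / fact e else 0) else 0)"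
    by (intro sum.cong) auto
  finally show ?thesis by simp
qed

lemma coeff_higher_bernoulli_poly_Stirling:
  assumes "1 \<le> k" "k \<le> n" "e \<le> n - k"
  shows "coeff (higher_bernoulli_poly (- int k) (n - k)) e =
    fact (n - k) / fact n * (of_nat (n choose e) * (fact k * of_nat (Stirling (n - e) k)))"
proof -
  have "n - k - e + k = n - e" using assms by simp
  then show ?thesis
    using assms
    by (simp add: coeff_higher_bernoulli_poly fps_nth_bernoulli_series binomial_fact)
qed

section \<open>Digit sums\<close>

locale digit_base =
  fixes p :: nat
  assumes p2: "2 \<le> p"
begin

abbreviation dsum :: "nat \<Rightarrow> nat" ("\<sigma>")
  where "\<sigma> \<equiv> digit_sum p"

lemma digit_sum_atMost: "n \<le> m \<Longrightarrow> \<sigma> n = (\<Sum>i\<le>m. digit p n i)"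
  unfolding digit_sum_def
proof (rule sum.mono_neutral_left)
  show "\<forall>i\<in>{..m} - {..n}. digit p n i = 0"
  proof
    fix i assume "i \<in> {..m} - {..n}"
    then have "n < i" by auto
    also have "i < p ^ i" using p2 by (intro power_gt_expt) auto
    finally show "digit p n i = 0" by (simp add: digit_def)
  qed
qed auto

lemma digit_sum_rec: "\<sigma> n = n mod p + \<sigma> (n div p)"
proof -
  have "\<sigma> n = (\<Sum>i\<le>Suc n. digit p n i)" by (rule digit_sum_atMost) simp
  also have "\<dots> = n mod p + (\<Sum>i\<le>n. digit p n (Suc i))"
    by (subst sum.atMost_Suc_shift) (simp add: digit_def)
  also have "(\<Sum>i\<le>n. digit p n (Suc i)) = (\<Sum>i\<le>n. digit p (n div p) i)"
    by (simp add: digit_def div_mult2_eq)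
  also have "\<dots> = \<sigma> (n div p)" by (rule digit_sum_atMost[symmetric]) simp
  finally show ?thesis .
qed

lemma digit_sum_0 [simp]: "\<sigma> 0 = 0"
  by (simp add: digit_sum_def digit_def)

lemma digit_sum_less: "c < p \<Longrightarrow> \<sigma> c = c"
  using digit_sum_rec[of c] digit_sum_0 by simp

lemma digit_sum_mult_add: "c < p \<Longrightarrow> \<sigma> (p * a + c) = \<sigma> a + c"
  using p2 by (subst digit_sum_rec) simp

lemma digit_sum_mult [simp]: "\<sigma> (p * a) = \<sigma> a"
  using digit_sum_mult_add[of 0 a] p2 by simp

lemma digit_induct [case_names zero step]:
  assumes "P 0" and "\<And>a c. c < p \<Longrightarrow> 0 < p * a + c \<Longrightarrow> P a \<Longrightarrow> P (p * a + c)"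
  shows "P n"
proof (induction n rule: less_induct)
  case (less n)
  show ?case
  proof (cases "n = 0")
    case False
    then have "n div p < n" using p2 by simp
    with less have "P (n div p)" by blast
    then have "P (p * (n div p) + n mod p)" using p2 False by (intro assms(2)) auto
    then show ?thesis by simp
  qed (use assms in simp)
qed

lemma digit_sum_add_power: "b < p ^ N \<Longrightarrow> \<sigma> (p ^ N * a + b) = \<sigma> a + \<sigma> b"
proof (induction N arbitrary: b)
  case (Suc N)
  have "b div p < p ^ N"
    using Suc.prems p2 by (simp add: less_mult_imp_div_less mult.commute)
  have "p ^ Suc N * a + b = p * (p ^ N * a + b div p) + b mod p"
    by (simp add: algebra_simps)
  then have "\<sigma> (p ^ Suc N * a + b) = \<sigma> (p ^ N * a + b div p) + b mod p"
    using digit_sum_mult_add p2 by simp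
  also have "\<dots> = \<sigma> a + (\<sigma> (b div p) + b mod p)"
    using Suc.IH[OF \<open>b div p < p ^ N\<close>] by simp
  also have "\<sigma> (b div p) + b mod p = \<sigma> b" by (subst (2) digit_sum_rec) simp
  finally show ?case .
qed simp

lemma digit_sum_mult_power [simp]: "\<sigma> (p ^ N * a) = \<sigma> a"
  using digit_sum_add_power[of 0 N a] p2 by simp

lemma digit_sum_pos: "0 < n \<Longrightarrow> 0 < \<sigma> n"
  by (induction n rule: digit_induct) (auto simp: digit_sum_mult_add)

lemma digit_sum_Suc_le: "\<sigma> (Suc n) \<le> Suc (\<sigma> n)"
proof (induction n rule: digit_induct)
  case zero
  show ?case using p2 digit_sum_less[of 1] by simp
next
  case (step a c)
  show ?case
  proof (cases "Suc c < p")
    case True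
    then show ?thesis using digit_sum_mult_add[of "Suc c" a] digit_sum_mult_add[of c a] by simp
  next
    case False
    with step have "c = p - 1" by simp
    then have *: "Suc (p * a + c) = p * Suc a" using p2 by simp
    show ?thesis using step digit_sum_mult_add[of c a] unfolding * digit_sum_mult by simp
  qed
qed

lemma digit_sum_add_le: "\<sigma> (m + n) \<le> \<sigma> m + \<sigma> n"
proof (induction m arbitrary: n rule: digit_induct)
  case (step a c)
  define b e where "b = n div p" and "e = n mod p"
  have n: "n = p * b + e" and e: "e < p" using p2 by (auto simp: b_def e_def)
  have s: "p * a + c + n = p * (a + b) + (c + e)" by (simp add: n algebra_simps)
  show ?case
  proof (cases "c + e < p")
    case True
    then show ?thesis unfolding s
      using step.IH[of b] step.hyps(1) e by (simp add: n digit_sum_mult_add)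
  next
    case False
    have "p * (a + b) + (c + e) = p * Suc (a + b) + (c + e - p)"
      using False by simp
    then have "\<sigma> (p * (a + b) + (c + e)) = \<sigma> (Suc (a + b)) + (c + e - p)"
      using step.hyps e digit_sum_mult_add[of "c + e - p" "Suc (a+b)"] by simp
    then show ?thesis unfolding s
      using step.IH[of b] step.hyps(1) e False digit_sum_Suc_le[of "a + b"] p2
      by (simp add: n digit_sum_mult_add)
  qed
qed simp

lemma digit_sum_le: "\<sigma> n \<le> n"
proof (induction n rule: digit_induct)
  case (step a c)
  have "1 * a \<le> p * a" using p2 by (intro mult_le_mono1) simp
  then have "a \<le> p * a" by simp
  with step show ?case using digit_sum_mult_add[of c a] by linarith
qed simp

lemma digit_sum_less_self: "p \<le> n \<Longrightarrow> \<sigma> n < n"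
proof -
  assume "p \<le> n"
  then have "n div p \<ge> 1" using p2 by (simp add: div_greater_zero_iff Suc_leI)
  then have "2 * (n div p) \<le> p * (n div p)" "n div p < 2 * (n div p)" using p2 by auto
  moreover have "n = p * (n div p) + n mod p" by simp
  moreover have "\<sigma> n \<le> n div p + n mod p"
    using digit_sum_rec[of n] digit_sum_le[of "n div p"] by simp
  ultimately show ?thesis by linarith
qed

lemma digit_sum_times_le: "\<sigma> (n * u) \<le> \<sigma> n * u"
proof (induction u)
  case (Suc u)
  then show ?case using digit_sum_add_le[of n "n * u"] by simp
qed simp

text \<open>Every carry lowers the digit sum by \<open>p - 1\<close>, and leaving the range below
  \<open>p ^ N\<close> needs at least one. Stripping the last digits, either they carry or the
  higher digits still overflow.\<close>

lemma digit_sum_carry: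
  "x < p ^ N \<Longrightarrow> y < p ^ N \<Longrightarrow> p ^ N \<le> x + y \<Longrightarrow> \<sigma> (x + y) + (p - 1) \<le> \<sigma> x + \<sigma> y"
proof (induction N arbitrary: x y)
  case (Suc N)
  define a c b e where "a = x div p" and "c = x mod p" and "b = y div p" and "e = y mod p"
  have x: "x = p * a + c" and c: "c < p" and y: "y = p * b + e" and e: "e < p"
    using p2 by (auto simp: a_def c_def b_def e_def)
  have s: "x + y = p * (a + b) + (c + e)" by (simp add: x y algebra_simps)
  have a: "a < p ^ N" and b: "b < p ^ N"
    using Suc.prems p2 by (simp_all add: a_def b_def less_mult_imp_div_less mult.commute)
  show ?case
  proof (cases "c + e < p")
    case True
    have "p ^ N \<le> a + b"
    proof (rule ccontr)
      assume "\<not> ?thesis"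
      then have "p * (a + b + 1) \<le> p * p ^ N" by (intro mult_le_mono2) simp
      with Suc.prems(3) True show False unfolding s by simp
    qed
    with Suc.IH[OF a b] True c e show ?thesis unfolding s by (simp add: x y digit_sum_mult_add)
  next
    case False
    have "p * (a + b) + (c + e) = p * Suc (a + b) + (c + e - p)"
      using False by simp
    then have "\<sigma> (x + y) = \<sigma> (Suc (a + b)) + (c + e - p)"
      using c e digit_sum_mult_add[of "c + e - p" "Suc (a+b)"] unfolding s by simp
    then show ?thesis
      using digit_sum_add_le[of a b] c e False digit_sum_Suc_le[of "a + b"] p2
      by (simp add: x y digit_sum_mult_add)
  qed
qed simp

lemma digit_sum_cong: "\<exists>z. n = \<sigma> n + (p - 1) * z"
proof (induction n rule: digit_induct)
  case (step a c)
  then obtain z where z: "a = \<sigma> a + (p - 1) * z" by blast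
  have "p = (p - 1) + 1" using p2 by simp
  then have "p * a = (p - 1) * a + a" by (metis add_mult_distrib mult_1)
  then have "p * a + c = \<sigma> (p * a + c) + (p - 1) * (a + z)"
    using z digit_sum_mult_add[OF step.hyps(1), of a] by (simp only: add_mult_distrib2)
  then show ?case by blast
qed auto

text \<open>The digit sum is congruent to the number modulo \<open>p - 1\<close>, so it is itself a
  positive multiple of \<open>p - 1\<close>.\<close>

lemma le_digit_sum_of_dvd: "p - 1 dvd n \<Longrightarrow> 0 < n \<Longrightarrow> p - 1 \<le> \<sigma> n"
  by (metis digit_sum_cong digit_sum_pos dvd_add_times_triv_right_iff dvd_imp_le mult.commute)

section \<open>Digit sum comparison for factors of index \<open>p - 1\<close> and leftover
  weight\<close>

text \<open>The two multiples of \<open>p ^ N * t\<close> combine to \<open>p ^ Suc N * t\<close>,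
  which has the digit sum of \<open>t\<close>, while \<open>\<rho>\<close> lies entirely below
  position \<open>N\<close>. Subadditivity does the rest.\<close>

lemma digit_sum_compare_above:
  assumes "d < p ^ N" and "\<rho> \<le> d"
  shows "\<sigma> (B + (p - 1) * (p ^ N * t) + (p ^ N * t + \<rho>)) \<le> \<sigma> B + \<sigma> (p ^ N * t + \<rho>)"
proof -
  have "(p - 1) * (p ^ N * t) + p ^ N * t = p ^ Suc N * t"
    using p2 by (cases p) (auto simp: algebra_simps)
  then have "B + (p - 1) * (p ^ N * t) + (p ^ N * t + \<rho>) = p ^ Suc N * t + (B + \<rho>)"
    by linarith
  then have "\<sigma> (B + (p - 1) * (p ^ N * t) + (p ^ N * t + \<rho>)) = \<sigma> (p ^ Suc N * t + (B + \<rho>))"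
    by (rule arg_cong)
  also have "\<dots> \<le> \<sigma> (p ^ Suc N * t) + \<sigma> (B + \<rho>)" by (rule digit_sum_add_le)
  also have "\<sigma> (p ^ Suc N * t) = \<sigma> t" by (rule digit_sum_mult_power)
  also have "\<sigma> t + \<sigma> (B + \<rho>) \<le> \<sigma> t + (\<sigma> B + \<sigma> \<rho>)"
    by (intro add_left_mono digit_sum_add_le)
  also have "\<sigma> t + \<sigma> \<rho> = \<sigma> (p ^ N * t + \<rho>)"
    using assms by (intro digit_sum_add_power[symmetric]) simp
  then have "\<sigma> t + (\<sigma> B + \<sigma> \<rho>) = \<sigma> B + \<sigma> (p ^ N * t + \<rho>)" by simp
  finally show ?thesis .
qed

text \<open>With \<open>r = p ^ N * t - \<eta>\<close>, the digits of all the numbers involved are compared separately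
  below and above position \<open>N\<close>; the borrow of \<open>B - \<eta>\<close> at position \<open>N\<close> decides the case.\<close>

lemma digit_sum_compare_below:
  assumes B: "p ^ N \<le> B" "B < p ^ Suc N" "(p - 1) * d < B"
    and \<eta>: "r + \<eta> = p ^ N * t" "0 < \<eta>"
  defines "V \<equiv> (p - 1) * (\<eta> + d)"
  shows "\<sigma> (B + (p - 1) * (p ^ N * t) + r) + (if V < p ^ N then 1 else 0) \<le> \<sigma> B + \<sigma> r + \<sigma> V"
proof -
  define q where "q = p ^ N"
  have q: "0 < q" using p2 by (simp add: q_def)
  define e1 e0 where "e1 = \<eta> div q" and "e0 = \<eta> mod q"
  have eta: "\<eta> = q * e1 + e0" and e0: "e0 < q" using q by (auto simp: e1_def e0_def)
  define b l where "b = B div q" and "l = B mod q"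
  have Bq: "B = q * b + l" and l: "l < q" using q by (auto simp: b_def l_def)
  have b1: "1 \<le> b" using B q by (simp add: b_def q_def[symmetric] div_greater_zero_iff Suc_leI)
  have bp: "b < p" using B by (simp add: b_def q_def less_mult_imp_div_less)
  have sB: "\<sigma> B = b + \<sigma> l"
    unfolding Bq using digit_sum_add_power[of l N b] l digit_sum_less[OF bp] by (simp add: q_def)
  \<comment> \<open>\<open>f\<close> is what the low part of \<open>V\<close> passes on to position
    \<open>N\<close>; it may exceed a single digit.\<close>
  define f v where "f = (p - 1) * (e0 + d) div q" and "v = (p - 1) * (e0 + d) mod q"
  have fv: "(p - 1) * (e0 + d) = q * f + v" and v: "v < q" using q by (auto simp: f_def v_def)
  define V1 where "V1 = (p - 1) * e1 + f"
  have "m * (q * e1 + e0 + d) = q * (m * e1) + m * (e0 + d)" for m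
    by (simp add: algebra_simps)
  then have Vq: "V = q * V1 + v"
    using fv unfolding V_def eta V1_def add_mult_distrib2[of q] by simp
  have sV: "\<sigma> V = \<sigma> V1 + \<sigma> v"
    unfolding Vq using digit_sum_add_power[of v N V1] v by (simp add: q_def)
  \<comment> \<open>Below \<open>p ^ N\<close> nothing reaches position \<open>N\<close>, so the
    extra unit is claimed only when \<open>\<eta>\<close> is its own low part
    \<open>e0\<close>.\<close>
  have small: "e1 = 0 \<and> f = 0 \<and> v = V" if "V < q"
  proof -
    have "V1 = 0" using that Vq q by (cases V1) auto
    then show ?thesis using p2 Vq by (simp add: V1_def)
  qed
  have qp: "(p - 1) * (q * x) + q * x = q * (p * x)" for x
    using p2 by (cases p) (auto simp: algebra_simps)
  show ?thesis
  proof (cases "e0 = 0")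
    case True
    have not_small: "\<not> V < q" using small \<eta> eta True by auto
    have "q * e1 \<le> q * t" using \<eta> eta unfolding q_def[symmetric] by linarith
    then have le: "e1 \<le> t" using q by simp
    define r1 where "r1 = t - e1"
    have t: "t = r1 + e1" using le by (simp add: r1_def)
    have r: "r = q * r1" using \<eta> eta True unfolding q_def[symmetric] t
      by (simp add: algebra_simps)
    have "q * f \<le> (p - 1) * d" using fv True by simp
    also have "\<dots> < B" by fact
    also have "B < q * Suc b" using Bq l by simp
    finally have "f < Suc b" by (simp only: mult_less_cancel1)
    then have fb: "f \<le> b" by simp
    have "(p - 1) * (q * e1) + b * q = q * ((p - 1) * e1 + b)" by (simp add: algebra_simps)
    then have "B + (p - 1) * (q * t) + r = q * (p * r1 + (V1 + (b - f))) + l"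
      using qp[of r1] fb unfolding Bq t r V1_def by (simp add: algebra_simps)
    then have "\<sigma> (B + (p - 1) * (q * t) + r) = \<sigma> (p * r1 + (V1 + (b - f))) + \<sigma> l"
      using digit_sum_add_power l by (simp add: q_def)
    moreover have "\<sigma> (p * r1 + (V1 + (b - f))) \<le> \<sigma> r1 + (\<sigma> V1 + (b - f))"
      using digit_sum_add_le[of "p * r1" "V1 + (b - f)"] digit_sum_add_le[of V1 "b - f"]
        digit_sum_le[of "b - f"] by simp
    moreover have "\<sigma> r = \<sigma> r1" unfolding r q_def by (rule digit_sum_mult_power)
    ultimately show ?thesis using not_small sB sV unfolding q_def by simp
  next
    case False
    have "q * e1 < q * t" using \<eta> eta False unfolding q_def[symmetric] by linarith
    then have lt: "e1 < t" using q by simp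
    define r1 r0 where "r1 = t - e1 - 1" and "r0 = q - e0"
    have t: "t = r1 + e1 + 1" using lt by (simp add: r1_def)
    have r0: "r0 + e0 = q" "r0 < q" using e0 False by (auto simp: r0_def)
    have "r + (q * e1 + e0) = q * r1 + q * e1 + q"
      using \<eta> eta unfolding q_def[symmetric] t by (simp add: algebra_simps)
    then have r: "r = q * r1 + r0" using r0 by linarith
    have sr: "\<sigma> r = \<sigma> r1 + \<sigma> r0"
      unfolding r q_def using r0 by (intro digit_sum_add_power) (simp add: q_def)
    have Vpos: "0 < (p - 1) * (e0 + d)" using p2 False by simp
    have base: "B + (p - 1) * (q * t) + r + e0 = q * (p * r1 + (p - 1) * e1 + p + b) + l"
    proof -
      have "(p - 1) * (q * t) = (p - 1) * (q * r1) + q * ((p - 1) * e1) + (p - 1) * (q * 1)"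
        unfolding t by (simp add: algebra_simps)
      then have "B + (p - 1) * (q * t) + r + e0
          = q * b + l + ((p - 1) * (q * r1) + q * r1) + q * ((p - 1) * e1) + ((p - 1) * (q * 1) + q * 1)"
        using r0 unfolding Bq r by linarith
      then show ?thesis unfolding qp by (simp add: algebra_simps)
    qed
    have upper: "q * f + v < q * (p - 1) + q * Suc b"
    proof -
      have "(p - 1) * e0 \<le> (p - 1) * q" using e0 by simp
      moreover have "B < q * Suc b" using Bq l by simp
      ultimately show ?thesis using fv B(3) by (simp add: algebra_simps)
    qed
    have "q * f < q * (p - 1 + Suc b)" using upper by (simp add: algebra_simps)
    then have "f < p - 1 + Suc b" by (simp only: mult_less_cancel1)
    then have fle: "f \<le> p - 1 + b" by simp
    show ?thesis
    proof (cases "e0 \<le> l")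
      case True
      have "B + (p - 1) * (q * t) + r = q * (p * r1 + (V1 + (p + b - f))) + (l - e0)"
      proof -
        have "p * r1 + (p - 1) * e1 + p + b = p * r1 + (V1 + (p + b - f))"
          using fle p2 unfolding V1_def by simp
        then show ?thesis using base True by (simp only:)
      qed
      then have "\<sigma> (B + (p - 1) * (q * t) + r) = \<sigma> (p * r1 + (V1 + (p + b - f))) + \<sigma> (l - e0)"
        using digit_sum_add_power[of "l - e0"] l by (simp add: q_def)
      moreover have "\<sigma> (p * r1 + (V1 + (p + b - f))) \<le> \<sigma> r1 + (\<sigma> V1 + (p + b - f))"
        using digit_sum_add_le[of "p * r1" "V1 + (p + b - f)"] digit_sum_add_le[of V1 "p + b - f"]
          digit_sum_le[of "p + b - f"] by simp
      moreover have "Suc (\<sigma> (l - e0)) + (p - 1) \<le> \<sigma> l + \<sigma> r0"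
      proof -
        have eq: "l + r0 = q * 1 + (l - e0)" using r0 True by simp
        have "\<sigma> (l + r0) = Suc (\<sigma> (l - e0))"
          unfolding eq using digit_sum_add_power[of "l - e0" N 1] l digit_sum_less[of 1] p2
          by (simp add: q_def)
        moreover have "\<sigma> (l + r0) + (p - 1) \<le> \<sigma> l + \<sigma> r0"
          using l r0 eq by (intro digit_sum_carry[of _ N]) (auto simp: q_def)
        ultimately show ?thesis by simp
      qed
      moreover have "0 < f + \<sigma> v"
        using Vpos digit_sum_pos[of v] unfolding fv by (cases "f = 0") simp_all
      ultimately have "\<sigma> (B + (p - 1) * (q * t) + r) + 1 \<le> \<sigma> B + \<sigma> r + \<sigma> V"
        using sB sr sV fle p2 by linarith
      then show ?thesis by (simp add: q_def)
    next
      case False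
      then have lr: "l + r0 < q" using r0 by simp
      have "B + (p - 1) * (q * t) + r + e0 = q * (p * r1 + (V1 + (p - 1 + b - f))) + (l + r0) + e0"
      proof -
        have "p * r1 + (p - 1) * e1 + p + b = p * r1 + (V1 + (p - 1 + b - f)) + 1"
          using fle p2 unfolding V1_def by simp
        then have "q * (p * r1 + (p - 1) * e1 + p + b) = q * (p * r1 + (V1 + (p - 1 + b - f))) + q"
          by (simp only: add_mult_distrib2 mult_1_right)
        then show ?thesis using base r0 by linarith
      qed
      then have "\<sigma> (B + (p - 1) * (q * t) + r)
          = \<sigma> (p * r1 + (V1 + (p - 1 + b - f))) + \<sigma> (l + r0)"
        using digit_sum_add_power lr by (simp add: q_def)
      moreover have "\<sigma> (p * r1 + (V1 + (p - 1 + b - f))) \<le> \<sigma> r1 + (\<sigma> V1 + \<sigma> (p - 1 + b - f))"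
        using digit_sum_add_le[of "p * r1" "V1 + (p - 1 + b - f)"]
          digit_sum_add_le[of V1 "p - 1 + b - f"] by simp
      moreover have "\<sigma> (l + r0) \<le> \<sigma> l + \<sigma> r0" by (rule digit_sum_add_le)
      \<comment> \<open>For \<open>f < b\<close> the number is \<open>p\<close> plus a digit and its
        digit sum collapses to \<open>b - f\<close>. Otherwise \<open>V\<close> is not below
        \<open>p ^ N\<close>, and either \<open>f\<close> is at least \<open>p - 1\<close> or the
        digit sum of the multiple \<open>(p - 1) * (e0 + d)\<close> supplies the missing
        amount.\<close>
      moreover have "\<sigma> (p - 1 + b - f) + (if V < q then 1 else 0) \<le> b + \<sigma> v"
      proof (cases "f < b")
        case True
        have "p - 1 + b - f = p * 1 + (b - 1 - f)" using True p2 by simp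
        moreover have "\<sigma> (p * 1 + (b - 1 - f)) = \<sigma> 1 + (b - 1 - f)"
          using bp by (intro digit_sum_mult_add) simp
        ultimately have "\<sigma> (p - 1 + b - f) = b - f" using True digit_sum_less[of 1] p2 by simp
        moreover have "0 < \<sigma> v" if "V < q"
          using small[OF that] Vpos unfolding fv by (intro digit_sum_pos) simp
        ultimately show ?thesis by auto
      next
        case fb: False
        then have "\<not> V < q" using small b1 by auto
        moreover have "\<sigma> (p - 1 + b - f) \<le> b + \<sigma> v"
        proof (cases "p - 1 \<le> f")
          case True
          then show ?thesis using digit_sum_le[of "p - 1 + b - f"] by simp
        next
          case False
          have "p - 1 \<le> \<sigma> ((p - 1) * (e0 + d))"
            using Vpos by (intro le_digit_sum_of_dvd) auto
          also have "\<dots> = \<sigma> f + \<sigma> v"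
            unfolding fv using digit_sum_add_power v by (simp add: q_def)
          finally show ?thesis
            using digit_sum_le[of f] digit_sum_le[of "p - 1 + b - f"] fb by simp
        qed
        ultimately show ?thesis by simp
      qed
      ultimately show ?thesis using sB sr sV unfolding q_def by linarith
    qed
  qed
qed

lemma digit_sum_compare:
  assumes B: "p ^ N \<le> B" "B < p ^ Suc N" "B = k + (p - 1) * d" "0 < k" "d < p ^ N"
    and V: "V + (p - 1) * r = (p - 1) * (p ^ N * t + d)"
  shows "\<sigma> (B + (p - 1) * (p ^ N * t) + r) \<le> \<sigma> B + \<sigma> r + \<sigma> V"
    and "0 < V \<Longrightarrow> V < p ^ N \<or> V = p - 1 \<Longrightarrow>
      \<sigma> (B + (p - 1) * (p ^ N * t) + r) < \<sigma> B + \<sigma> r + \<sigma> V"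
proof -
  have "\<sigma> (B + (p - 1) * (p ^ N * t) + r) + (if 0 < V \<and> (V < p ^ N \<or> V = p - 1) then 1 else 0)
      \<le> \<sigma> B + \<sigma> r + \<sigma> V"
  proof (cases "p ^ N * t \<le> r")
    case True
    then obtain \<rho> where \<rho>: "r = p ^ N * t + \<rho>" using le_Suc_ex by blast
    have "(p - 1) * r \<le> (p - 1) * (p ^ N * t + d)" using V by linarith
    then have "\<rho> \<le> d" using p2 \<rho> by simp
    from digit_sum_compare_above[OF B(5) this, of B t] show ?thesis
      using digit_sum_pos[of V] unfolding \<rho> by auto
  next
    case False
    define \<eta> where "\<eta> = p ^ N * t - r"
    have eta: "r + \<eta> = p ^ N * t" "0 < \<eta>" using False by (auto simp: \<eta>_def)
    have Ve: "V = (p - 1) * (\<eta> + d)"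
      using V unfolding eta(1)[symmetric] add_mult_distrib2 by linarith
    have "(p - 1) * d < B" using B by simp
    from digit_sum_compare_below[OF B(1,2) this eta]
    have *: "\<sigma> (B + (p - 1) * (p ^ N * t) + r) + (if V < p ^ N then 1 else 0)
      \<le> \<sigma> B + \<sigma> r + \<sigma> V" unfolding Ve by simp
    show ?thesis
    proof (cases "V = p - 1 \<and> \<not> V < p ^ N")
      case True
      have "N = 0"
      proof (rule ccontr)
        assume "N \<noteq> 0"
        then have "p \<le> p ^ N" using p2 by (intro self_le_power) auto
        then show False using True p2 by linarith
      qed
      have "\<eta> + d = 1" using Ve True p2 by simp
      with eta have "\<eta> = 1" "d = 0" by auto
      then have t: "t = Suc r" using eta \<open>N = 0\<close> by simp
      \<comment> \<open>With \<open>N = 0\<close> the single digit of \<open>B\<close> drops by one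
        while \<open>r\<close> grows by one, so the sum can be computed outright.\<close>
      have "B + (p - 1) * t + r = p * Suc r + (B - 1)"
        unfolding t using B(3,4) p2 by (cases p) (auto simp: algebra_simps)
      moreover have "\<sigma> (p * Suc r + (B - 1)) = \<sigma> (Suc r) + (B - 1)"
        using B(2) \<open>N = 0\<close> by (intro digit_sum_mult_add) simp
      ultimately have "\<sigma> (B + (p - 1) * t + r) = \<sigma> (Suc r) + (B - 1)" by (simp only:)
      moreover have "\<sigma> B = B" using B \<open>N = 0\<close> by (intro digit_sum_less) simp
      moreover have "0 < \<sigma> V" using True p2 by (intro digit_sum_pos) simp
      ultimately show ?thesis using digit_sum_Suc_le[of r] B \<open>N = 0\<close> by auto
    next
      case False
      then show ?thesis using * by auto
    qed
  qed
  then show "\<sigma> (B + (p - 1) * (p ^ N * t) + r) \<le> \<sigma> B + \<sigma> r + \<sigma> V"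
    and "0 < V \<Longrightarrow> V < p ^ N \<or> V = p - 1 \<Longrightarrow>
      \<sigma> (B + (p - 1) * (p ^ N * t) + r) < \<sigma> B + \<sigma> r + \<sigma> V"
    by (auto split: if_splits)
qed

text \<open>For prime \<open>p\<close> this is \<open>i - (p - 1) * multiplicity p (i + 1)\<close>.\<close>

definition gap :: "nat \<Rightarrow> nat"
  where "gap i = i + \<sigma> (Suc i) - Suc (\<sigma> i)"

lemma gap_add: "gap i + Suc (\<sigma> i) = i + \<sigma> (Suc i)"
  unfolding gap_def using digit_sum_le[of i] digit_sum_pos[of "Suc i"] by simp

lemma gap_less: "i < p - 1 \<Longrightarrow> gap i = i"
  using gap_add[of i] digit_sum_less[of i] digit_sum_less[of "Suc i"] by simp

lemma gap_pred [simp]: "gap (p - 1) = 0"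
  using gap_add[of "p - 1"] digit_sum_less[of "p - 1"] digit_sum_mult[of 1] digit_sum_less[of 1] p2
  by simp

lemma digit_sum_Suc_le_gap:
  assumes "p \<le> i"
  shows "\<sigma> (Suc i) \<le> gap i"
  using gap_add[of i] digit_sum_less_self[OF assms] by simp

text \<open>An index \<open>i \<ge> p\<close> is later traded for \<open>p - 1\<close> and a rest
  \<open>i - (p - 1)\<close>; its gap must pay for the digits of the rest, with one unit to spare.
  The gap is less than \<open>i\<close> only if the last digit of \<open>i\<close> is
  \<open>p - 1\<close>. For \<open>p = 2\<close>, \<open>i = 3\<close> no unit is left, because
  \<open>i + 1 = 4\<close> is divisible by 4 and the gap is only 1.\<close>

lemma digit_sum_diff_le_gap:
  assumes "p \<le> i"
  shows "\<sigma> (i - (p - 1)) + (if p = 2 \<and> i = 3 then 0 else 1) \<le> gap i"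
proof -
  define a c where "a = i div p" and "c = i mod p"
  have i: "i = p * a + c" and c: "c < p" using p2 by (auto simp: a_def c_def)
  have a: "1 \<le> a" using assms p2 by (simp add: a_def div_greater_zero_iff Suc_leI)
  have si: "\<sigma> i = \<sigma> a + c" unfolding i by (rule digit_sum_mult_add[OF c])
  show ?thesis
  proof (cases "Suc c < p")
    case True
    have "\<sigma> (Suc i) = \<sigma> a + Suc c"
      unfolding i using digit_sum_mult_add[OF True, of a] by simp
    then have "gap i = i" using gap_add[of i] si by simp
    then show ?thesis using digit_sum_le[of "i - (p - 1)"] p2 assms by auto
  next
    case False
    then have c: "c = p - 1" using c by simp
    then have "Suc i = p * Suc a" using i p2 by simp
    then have "\<sigma> (Suc i) = \<sigma> (Suc a)" by (simp only: digit_sum_mult)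
    then have g: "gap i + Suc (\<sigma> a) = p * a + \<sigma> (Suc a)"
      using gap_add[of i] si c i by simp
    have *: "\<sigma> (i - (p - 1)) = \<sigma> a" using i c by simp
    have pos: "0 < \<sigma> (Suc a)" by (rule digit_sum_pos) simp
    show ?thesis
    proof (cases "p = 2")
      case True
      show ?thesis
      proof (cases "a = 1")
        case True
        then show ?thesis using g pos * \<open>p = 2\<close> i c digit_sum_le[of a] by simp
      next
        case False
        then have "\<sigma> a < a" using a \<open>p = 2\<close> by (intro digit_sum_less_self) simp
        then show ?thesis using g pos * \<open>p = 2\<close> i c by auto
      qed
    next
      case False
      then have "3 * a \<le> p * a" using p2 by (intro mult_le_mono1) simp
      then have "Suc (\<sigma> a) \<le> gap i" using g pos digit_sum_le[of a] a by linarith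
      then show ?thesis using * False by simp
    qed
  qed
qed

text \<open>\<open>reach j w Q\<close>: there are multiplicities \<open>u\<^sub>i\<close> of the numbers \<open>i \<ge> 1\<close> with sum \<open>j\<close>, weight
  \<open>\<Sum>i u\<^sub>i = w\<close> and cost \<open>\<Sum>(gap i u\<^sub>i + \<sigma> u\<^sub>i) = Q\<close>.\<close>

inductive reach :: "nat \<Rightarrow> nat \<Rightarrow> nat \<Rightarrow> bool" where
  reach_0: "reach 0 0 0"
| reach_add: "reach j w Q \<Longrightarrow> 1 \<le> i \<Longrightarrow> reach (j + u) (w + i * u) (Q + gap i * u + \<sigma> u)"

text \<open>\<open>r\<close> factors have index \<open>p - 1\<close>, \<open>q1\<close> factors of
  weight \<open>w1\<close> have a smaller index, and \<open>q2\<close> factors have a larger one,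
  \<open>x\<close> being their weight in excess of \<open>p - 1\<close> each. The charge
  \<open>A\<close> for the last group is a parameter because the weak bound and the two strict
  bounds need different charges.\<close>

definition dec :: "(nat \<Rightarrow> nat \<Rightarrow> nat) \<Rightarrow> nat \<Rightarrow> nat \<Rightarrow> nat \<Rightarrow> nat \<Rightarrow> nat \<Rightarrow> nat \<Rightarrow> nat \<Rightarrow> nat \<Rightarrow> bool"
  where "dec A j w Q r q1 w1 q2 x \<longleftrightarrow>
    j = r + q1 + q2 \<and> w = (p - 1) * (r + q2) + w1 + x \<and> \<sigma> r + \<sigma> q1 + w1 + A q2 x \<le> Q \<and>
    q1 \<le> w1 \<and> q2 \<le> x \<and> (q2 = 0 \<longrightarrow> x = 0)"

text \<open>The parts \<open>i < p - 1\<close>, \<open>i = p - 1\<close> and \<open>i \<ge> p\<close> are collected separately, the last ones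
  after moving \<open>p - 1\<close> units of weight to the middle ones.\<close>

lemma dec_add:
  assumes A: "\<And>q x q' x'. A (q + q') (x + x') \<le> A q x + A q' x'"
      "\<And>i u. p \<le> i \<Longrightarrow> 1 \<le> u \<Longrightarrow> A u ((i - (p - 1)) * u) \<le> gap i * u + \<sigma> u"
    and d: "dec A j w Q r q1 w1 q2 x" and i: "1 \<le> i" and u: "1 \<le> u"
  shows "\<exists>r q1' w1 q2' x. dec A (j + u) (w + i * u) (Q + gap i * u + \<sigma> u) r q1' w1 q2' x \<and>
    (q1 + q2 + (if i = p - 1 then 0 else u) \<le> q1' + q2')"
proof -
  consider "i < p - 1" | "i = p - 1" | "p \<le> i" by linarith
  then show ?thesis
  proof cases
    case 1
    define v where "v = i * u"
    have "u \<le> v" using i by (simp add: v_def)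
    then have "dec A (j + u) (w + v) (Q + v + \<sigma> u) r (q1 + u) (w1 + v) q2 x"
      using d digit_sum_add_le[of q1 u] by (auto simp: dec_def)
    then show ?thesis using 1 unfolding v_def gap_less[OF 1] by (intro exI) auto
  next
    case 2
    have "dec A (j + u) (w + i * u) (Q + gap i * u + \<sigma> u) (r + u) q1 w1 q2 x"
      using d digit_sum_add_le[of r u] unfolding 2 gap_pred by (auto simp: dec_def add_mult_distrib2)
    then show ?thesis using 2 by (intro exI) auto
  next
    case 3
    define v where "v = (i - (p - 1)) * u"
    have eq: "i * u = (p - 1) * u + v"
      unfolding v_def add_mult_distrib[symmetric] using 3 by simp
    have "1 * u \<le> v" unfolding v_def using 3 p2 by (intro mult_le_mono1) linarith
    moreover have "A (q2 + u) (x + v) \<le> A q2 x + (gap i * u + \<sigma> u)"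
      using A(1)[of q2 u x v] A(2)[OF 3 u] unfolding v_def by linarith
    ultimately
    have "dec A (j + u) (w + i * u) (Q + gap i * u + \<sigma> u) r q1 w1 (q2 + u) (x + v)"
      using d u unfolding eq by (auto simp: dec_def add_mult_distrib2)
    then show ?thesis using 3 by (intro exI) auto
  qed
qed

lemma reach_dec:
  assumes A: "\<And>q x q' x'. A (q + q') (x + x') \<le> A q x + A q' x'"
      "\<And>i u. p \<le> i \<Longrightarrow> 1 \<le> u \<Longrightarrow> A u ((i - (p - 1)) * u) \<le> gap i * u + \<sigma> u"
    and A0: "A 0 0 = 0" and "reach j w Q"
  shows "\<exists>r q1 w1 q2 x. dec A j w Q r q1 w1 q2 x"
  using assms(4)
proof induction
  case reach_0
  have "dec A 0 0 0 0 0 0 0 0" by (simp add: dec_def A0)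
  then show ?case by blast
next
  case (reach_add j w Q i u)
  show ?case
  proof (cases "u = 0")
    case False
    obtain r q1 w1 q2 x where "dec A j w Q r q1 w1 q2 x" using reach_add.IH by blast
    moreover have "1 \<le> u" using False by simp
    ultimately show ?thesis using dec_add[OF A _ reach_add.hyps(2)] by blast
  qed (use reach_add in simp)
qed

inductive reach_other :: "nat \<Rightarrow> nat \<Rightarrow> nat \<Rightarrow> bool" where
  "reach j w Q \<Longrightarrow> 1 \<le> i \<Longrightarrow> i \<noteq> p - 1 \<Longrightarrow> 1 \<le> u \<Longrightarrow>
    reach_other (j + u) (w + i * u) (Q + gap i * u + \<sigma> u)"

lemma reach_other_dec:
  assumes A: "\<And>q x q' x'. A (q + q') (x + x') \<le> A q x + A q' x'"
      "\<And>i u. p \<le> i \<Longrightarrow> 1 \<le> u \<Longrightarrow> A u ((i - (p - 1)) * u) \<le> gap i * u + \<sigma> u"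
    and A0: "A 0 0 = 0" and "reach_other j w Q"
  shows "\<exists>r q1 w1 q2 x. dec A j w Q r q1 w1 q2 x \<and> 0 < q1 + q2"
  using assms(4)
proof cases
  case (1 j w Q i u)
  obtain r q1 w1 q2 x where "dec A j w Q r q1 w1 q2 x" using reach_dec[OF A A0 1(4)] by blast
  from dec_add[OF A this 1(5,7)] obtain r q1' w1 q2' x
    where "dec A (j + u) (w + i * u) (Q + gap i * u + \<sigma> u) r q1' w1 q2' x" "u \<le> q1' + q2'"
    using 1(6) by auto
  moreover have "0 < q1' + q2'" using calculation(2) 1(7) by linarith
  ultimately show ?thesis unfolding 1(1-3) by blast
qed

section \<open>Digit sum bounds for the terms of the expansion\<close>

text \<open>After trading, \<open>r + q2\<close> factors of index \<open>p - 1\<close> face the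
  leftover weight \<open>w' + w1 + x\<close>, which is the situation of
  \<open>digit_sum_compare\<close>. The \<open>q1\<close> factors of small index are split off by
  subadditivity; they have paid for their weight in full.\<close>

lemma reach_le:
  assumes B: "p ^ N \<le> B" "B < p ^ Suc N" "B = k + (p - 1) * d" "0 < k" "d < p ^ N"
    and w: "w + w' + k = B + (p - 1) * (p ^ N * t)" and R: "reach j w Q"
  shows "\<sigma> (B + (p - 1) * (p ^ N * t) + j) \<le> \<sigma> B + Q + \<sigma> w'"
proof -
  define A where "A = (\<lambda>q x. \<sigma> q + \<sigma> x)"
  have "\<exists>r q1 w1 q2 x. dec A j w Q r q1 w1 q2 x"
  proof (rule reach_dec[OF _ _ _ R])
    show "A (q + q') (x + x') \<le> A q x + A q' x'" for q q' x x'
      using digit_sum_add_le[of q q'] digit_sum_add_le[of x x'] by (simp add: A_def)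
    show "A u ((i - (p - 1)) * u) \<le> gap i * u + \<sigma> u" if "p \<le> i" for i u
    proof -
      have "\<sigma> ((i - (p - 1)) * u) \<le> \<sigma> (i - (p - 1)) * u" by (rule digit_sum_times_le)
      also have "\<dots> \<le> gap i * u"
        using digit_sum_diff_le_gap[OF that] by (intro mult_le_mono1) simp
      finally show ?thesis by (simp add: A_def)
    qed
  qed (simp add: A_def)
  then obtain r q1 w1 q2 x where d: "dec A j w Q r q1 w1 q2 x" by blast
  have "w' + w1 + x + (p - 1) * (r + q2) = (p - 1) * (p ^ N * t + d)"
    using d w B(3) unfolding dec_def add_mult_distrib2 by linarith
  from digit_sum_compare(1)[OF B this]
  have "\<sigma> (B + (p - 1) * (p ^ N * t) + (r + q2)) \<le> \<sigma> B + \<sigma> (r + q2) + \<sigma> (w' + w1 + x)" .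
  moreover have "\<sigma> (B + (p - 1) * (p ^ N * t) + j)
      \<le> \<sigma> (B + (p - 1) * (p ^ N * t) + (r + q2)) + \<sigma> q1"
    using d digit_sum_add_le[of "B + (p - 1) * (p ^ N * t) + (r + q2)" q1]
    by (simp add: dec_def algebra_simps)
  moreover have "\<sigma> (w' + w1 + x) \<le> \<sigma> w' + w1 + \<sigma> x"
    using digit_sum_add_le[of "w' + w1" x] digit_sum_add_le[of w' w1] digit_sum_le[of w1]
    by linarith
  moreover have "\<sigma> r + \<sigma> q1 + w1 + (\<sigma> q2 + \<sigma> x) \<le> Q" using d by (simp add: dec_def A_def)
  ultimately show ?thesis using digit_sum_add_le[of r q2] by linarith
qed

lemma reach_less_large:
  assumes B: "p ^ N \<le> B" "B < p ^ Suc N" "B = k + (p - 1) * d" "0 < k" "d < p ^ N"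
    and w: "w + w' + k = B + (p - 1) * (p ^ N * t)"
    and R: "reach j w Q \<and> 0 < w' \<or> reach_other j w Q"
    and N: "1 \<le> N" "3 \<le> p \<or> 2 \<le> N"
  shows "\<sigma> (B + (p - 1) * (p ^ N * t) + j) < \<sigma> B + Q + w'"
proof -
  \<comment> \<open>The added unit replaces the strictness that \<open>digit_sum_compare\<close> may
    lack from \<open>p ^ N\<close> on. Subadditivity survives, because reaching \<open>p ^ N\<close>
    from two smaller numbers costs a carry worth \<open>p - 1 \<ge> 1\<close>.\<close>
  define \<tau> where "\<tau> x = \<sigma> x + (if p ^ N \<le> x then 1 else 0)" for x
  define A where "A = (\<lambda>q x. \<sigma> q + \<tau> x)"
  have \<tau>_add: "\<tau> (x + y) \<le> \<tau> x + \<tau> y" for x y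
  proof (cases "x < p ^ N \<and> y < p ^ N \<and> p ^ N \<le> x + y")
    case True
    then have "\<sigma> (x + y) + (p - 1) \<le> \<sigma> x + \<sigma> y" using digit_sum_carry by blast
    then show ?thesis using True p2 by (simp add: \<tau>_def)
  next
    case False
    then show ?thesis using digit_sum_add_le[of x y] by (auto simp: \<tau>_def)
  qed
  have A_add: "A (q + q') (x + x') \<le> A q x + A q' x'" for q q' x x'
    using digit_sum_add_le[of q q'] \<tau>_add[of x x'] by (simp add: A_def)
  have pN: "p \<le> p ^ N" using N p2 by (simp add: self_le_power)
  have \<tau>_le: "\<tau> x \<le> x" for x
    using digit_sum_le[of x] digit_sum_less_self[of x] pN by (auto simp: \<tau>_def)
  have A_gap: "A u ((i - (p - 1)) * u) \<le> gap i * u + \<sigma> u" if i: "p \<le> i" and u: "1 \<le> u" for i u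
  proof -
    have "\<tau> ((i - (p - 1)) * u) \<le> gap i * u"
    \<comment> \<open>The index whose gap has no unit to spare. For \<open>u = 1\<close> the rest is
      2, below \<open>p ^ N \<ge> 4\<close>, so \<open>\<tau>\<close> adds nothing; for larger
      \<open>u\<close> the unit comes from \<open>\<sigma> u < u\<close>.\<close>
    proof (cases "p = 2 \<and> i = 3")
      case True
      have "(2::nat) ^ 2 \<le> 2 ^ N" using N True by (intro power_increasing) auto
      then have pN: "4 \<le> p ^ N" using True by simp
      have "1 \<le> gap i" using digit_sum_Suc_le_gap[OF i] digit_sum_pos[of "Suc i"] by simp
      then have "u \<le> gap i * u" by simp
      moreover have "\<tau> (p * u) \<le> u"
      proof (cases "u = 1")
        case True
        have "\<sigma> p = 1" using digit_sum_mult[of 1] digit_sum_less[of 1] p2 by simp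
        then show ?thesis using True pN \<open>p = 2 \<and> i = 3\<close>
          by (simp add: \<tau>_def del: digit_sum_mult)
      next
        case False
        then have "\<sigma> u < u" using u True by (intro digit_sum_less_self) simp
        then show ?thesis by (simp add: \<tau>_def)
      qed
      ultimately have "\<tau> (p * u) \<le> gap i * u" by linarith
      moreover have "i - (p - 1) = p" using True by simp
      ultimately show ?thesis by simp
    next
      case False
      have "\<tau> ((i - (p - 1)) * u) \<le> \<sigma> (i - (p - 1)) * u + u"
        using digit_sum_times_le[of "i - (p - 1)" u] u by (simp add: \<tau>_def)
      also have "\<dots> = (\<sigma> (i - (p - 1)) + 1) * u" by simp
      also have "\<dots> \<le> gap i * u"
        using digit_sum_diff_le_gap[OF i] False by (intro mult_le_mono1) (simp split: if_splits)
      finally show ?thesis .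
    qed
    then show ?thesis by (simp add: A_def)
  qed
  have A0: "A 0 0 = 0" using p2 by (simp add: A_def \<tau>_def)
  obtain r q1 w1 q2 x where d: "dec A j w Q r q1 w1 q2 x" and pos: "0 < w' + q1 + q2"
    using R reach_dec[OF A_add A_gap A0] reach_other_dec[OF A_add A_gap A0] by (metis add_gr_0)
  define V where "V = w' + w1 + x"
  have "0 < V" using pos d by (auto simp: V_def dec_def)
  have V: "V + (p - 1) * (r + q2) = (p - 1) * (p ^ N * t + d)"
    using d w B(3) unfolding dec_def V_def add_mult_distrib2 by linarith
  have "\<sigma> (B + (p - 1) * (p ^ N * t) + (r + q2)) < \<sigma> B + \<sigma> (r + q2) + \<tau> V"
    using digit_sum_compare[OF B V] \<open>0 < V\<close> by (auto simp: \<tau>_def)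
  moreover have "\<sigma> (B + (p - 1) * (p ^ N * t) + j)
      \<le> \<sigma> (B + (p - 1) * (p ^ N * t) + (r + q2)) + \<sigma> q1"
    using d digit_sum_add_le[of "B + (p - 1) * (p ^ N * t) + (r + q2)" q1]
    by (simp add: dec_def algebra_simps)
  moreover have "\<tau> V \<le> w' + w1 + \<tau> x"
    using \<tau>_add[of "w' + w1" x] \<tau>_le[of "w' + w1"] by (simp add: V_def)
  moreover have "\<sigma> r + \<sigma> q1 + w1 + (\<sigma> q2 + \<tau> x) \<le> Q" using d by (simp add: dec_def A_def)
  ultimately show ?thesis using digit_sum_add_le[of r q2] by linarith
qed

text \<open>For \<open>N = 0\<close>, and for \<open>p = 2\<close>, \<open>N = 1\<close>, the part \<open>\<tau>\<close> of the previous proof is too large for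
  small \<open>i \<ge> p\<close>, but there \<open>\<sigma> k \<le> \<sigma> B\<close> and \<open>n + j\<close> may be compared with \<open>k\<close> instead of \<open>B\<close>.\<close>

lemma reach_less_small:
  assumes B: "p ^ N \<le> B" "B < p ^ Suc N" "B = k + (p - 1) * d" "0 < k" "d < p ^ N"
    and w: "w + w' + k = B + (p - 1) * (p ^ N * t)"
    and R: "reach j w Q \<and> 0 < w' \<or> reach_other j w Q"
    and sk: "\<sigma> k \<le> \<sigma> B"
  shows "\<sigma> (B + (p - 1) * (p ^ N * t) + j) < \<sigma> B + Q + w'"
proof -
  \<comment> \<open>A factor of index \<open>i\<close> adds \<open>i + 1 = (i - (p - 1)) + p\<close>
    to \<open>n + j\<close>, hence \<open>x + p * q\<close>. The extra unit provides strictness as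
    soon as such a factor occurs.\<close>
  define A where "A = (\<lambda>q x. \<sigma> (x + p * q) + (if 0 < q then 1 else 0))"
  have A_add: "A (q + q') (x + x') \<le> A q x + A q' x'" for q q' x x'
    using digit_sum_add_le[of "x + p * q" "x' + p * q'"] by (auto simp: A_def algebra_simps)
  have A_gap: "A u ((i - (p - 1)) * u) \<le> gap i * u + \<sigma> u" if i: "p \<le> i" and u: "1 \<le> u" for i u
  proof -
    have "(i - (p - 1)) * u + p * u = Suc i * u"
      unfolding add_mult_distrib[symmetric] using i p2 by simp
    moreover have "\<sigma> (Suc i * u) \<le> gap i * u"
      using digit_sum_times_le[of "Suc i" u] digit_sum_Suc_le_gap[OF i]
      by (meson le_trans mult_le_mono1)
    moreover have "1 \<le> \<sigma> u" using digit_sum_pos[of u] u by simp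
    ultimately show ?thesis by (simp add: A_def)
  qed
  have A0: "A 0 0 = 0" by (simp add: A_def)
  obtain r q1 w1 q2 x where d: "dec A j w Q r q1 w1 q2 x" and pos: "0 < w' + q1 + q2"
    using R reach_dec[OF A_add A_gap A0] reach_other_dec[OF A_add A_gap A0] by (metis add_gr_0)
  have Q: "\<sigma> r + \<sigma> q1 + w1 + A q2 x \<le> Q" using d by (simp add: dec_def)
  show ?thesis
  proof (cases "q2 = 0")
    case True
    have x: "x = 0" using d True by (simp add: dec_def)
    define V where "V = w' + w1"
    have "0 < V" using pos d True by (auto simp: V_def dec_def)
    have V: "V + (p - 1) * r = (p - 1) * (p ^ N * t + d)"
      using d w B(3) True x unfolding dec_def V_def add_mult_distrib2 by simp
    have "\<sigma> (B + (p - 1) * (p ^ N * t) + r) < \<sigma> B + \<sigma> r + V"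
    \<comment> \<open>\<open>V\<close> is a positive multiple of \<open>p - 1\<close>: either
      \<open>V \<ge> p\<close>, where \<open>\<sigma> V < V\<close>, or \<open>V = p - 1\<close>,
      where the comparison itself is strict.\<close>
    proof (cases "p \<le> V")
      case True
      then show ?thesis using digit_sum_compare(1)[OF B V] digit_sum_less_self[of V] by simp
    next
      case False
      have "p - 1 dvd V" using V by (metis dvd_add_left_iff dvd_triv_left)
      then have "p - 1 \<le> V" using \<open>0 < V\<close> by (rule dvd_imp_le)
      then have "V = p - 1" using False by simp
      then show ?thesis
        using digit_sum_compare(2)[OF B V] \<open>0 < V\<close> digit_sum_le[of V] by simp
    qed
    moreover have "\<sigma> (B + (p - 1) * (p ^ N * t) + j) \<le> \<sigma> (B + (p - 1) * (p ^ N * t) + r) + \<sigma> q1"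
      using d digit_sum_add_le[of "B + (p - 1) * (p ^ N * t) + r" q1] True
      by (simp add: dec_def algebra_simps)
    ultimately show ?thesis using Q by (simp add: V_def)
  next
    case False
    have pr: "(p - 1) * a + a = p * a" for a using p2 by (cases p) auto
    have "B + (p - 1) * (p ^ N * t) + j = k + p * r + w' + (w1 + q1) + (x + p * q2)"
      using d w pr[of r] pr[of q2] unfolding dec_def add_mult_distrib2 by linarith
    moreover have "\<sigma> (k + p * r + w' + (w1 + q1) + (x + p * q2))
        \<le> \<sigma> k + \<sigma> r + \<sigma> w' + (\<sigma> w1 + \<sigma> q1) + \<sigma> (x + p * q2)"
      using digit_sum_add_le[of "k + p * r + w' + (w1 + q1)" "x + p * q2"]
        digit_sum_add_le[of "k + p * r + w'" "w1 + q1"] digit_sum_add_le[of w1 q1]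
        digit_sum_add_le[of "k + p * r" w'] digit_sum_add_le[of k "p * r"] digit_sum_mult[of r]
      by linarith
    ultimately show ?thesis
      using Q False sk digit_sum_le[of w'] digit_sum_le[of w1] by (simp add: A_def)
  qed
qed

lemma reach_less:
  assumes B: "p ^ N \<le> B" "B < p ^ Suc N" "B = k + (p - 1) * d" "0 < k" "d < p ^ N"
    and w: "w + w' + k = B + (p - 1) * (p ^ N * t)"
    and R: "reach j w Q \<and> 0 < w' \<or> reach_other j w Q"
  shows "\<sigma> (B + (p - 1) * (p ^ N * t) + j) < \<sigma> B + Q + w'"
proof (cases "1 \<le> N \<and> (3 \<le> p \<or> 2 \<le> N)")
  case True
  then show ?thesis using reach_less_large[OF B w R] by blast
next
  case False
  have "\<sigma> k \<le> \<sigma> B"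
  proof (cases "N = 0")
    case True
    then show ?thesis using B by simp
  next
    case False
    with \<open>\<not> (1 \<le> N \<and> (3 \<le> p \<or> 2 \<le> N))\<close> have p: "p = 2" "N = 1" using p2 by auto
    have s: "\<sigma> 1 = 1" "\<sigma> 2 = 1" "\<sigma> 3 = 2"
      using p digit_sum_less[of 1] digit_sum_mult[of 1] digit_sum_mult_add[of 1 1] by simp_all
    have "B = 2 \<or> B = 3" "1 \<le> k" "k \<le> B" using B p by auto
    then consider "k = B" | "k = 1" | "B = 3" "k = 2" by linarith
    then show ?thesis using s \<open>B = 2 \<or> B = 3\<close> by cases auto
  qed
  then show ?thesis using reach_less_small[OF B w R] by blast
qed

lemma digit_sum_le_reach: "reach j w Q \<Longrightarrow> \<sigma> j \<le> Q"
proof (induction rule: reach.induct)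
  case (reach_add j w Q i u)
  then show ?case using digit_sum_add_le[of j u] by simp
qed simp

text \<open>Every index other than \<open>p - 1\<close> has positive gap. With subadditivity this
  gives a strict bound that does not presuppose \<open>d < p ^ N\<close>, as needed when that
  inequality is still to be derived.\<close>

lemma digit_sum_less_reach_other: "reach_other j w Q \<Longrightarrow> \<sigma> j < Q"
proof (induction rule: reach_other.induct)
  case (1 j w Q i u)
  have "0 < gap i"
  proof (cases "i < p - 1")
    case True
    then show ?thesis using 1 by (simp add: gap_less)
  next
    case False
    then have "p \<le> i" using 1 by linarith
    then show ?thesis using digit_sum_Suc_le_gap[of i] digit_sum_pos[of "Suc i"] by simp
  qed
  then have "0 < gap i * u" using 1 by simp
  then show ?case using digit_sum_add_le[of j u] digit_sum_le_reach[OF 1(1)] by linarith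
qed

lemma power_dvd_if_low_digits_0: "(\<And>i. i < N \<Longrightarrow> digit p n i = 0) \<Longrightarrow> p ^ N dvd n"
proof (induction N)
  case (Suc N)
  then obtain s where s: "n = p ^ N * s" by auto
  moreover have "digit p n N = 0" using Suc.prems by simp
  ultimately have "p dvd s" using p2 by (simp add: digit_def dvd_eq_mod_eq_0)
  then show ?case unfolding s by (simp add: mult_dvd_mono mult.commute)
qed simp

end

section \<open>Valuations\<close>

locale prime_base = digit_base +
  assumes prime_p: "prime p"
begin

section \<open>Valuations of rational numbers\<close>

lemma prime_elem_p: "prime_elem (int p)"
  using prime_p by simp

lemma not_unit_p: "\<not> is_unit (int p)"
  using p2 by simp

lemma padic_val_frac:
  assumes "a \<noteq> 0" "b \<noteq> 0"
  shows "padic_val p (of_int a / of_int b) =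
    int (multiplicity (int p) a) - int (multiplicity (int p) b)"
proof -
  let ?x = "rat_of_int a / rat_of_int b"
  obtain n m where q: "quotient_of ?x = (n, m)" by (cases "quotient_of ?x")
  have m: "m > 0" using q by (rule quotient_of_denom_pos)
  have x: "?x = of_int n / of_int m" using q by (rule quotient_of_div)
  then have n: "n \<noteq> 0" using assms by auto
  have "rat_of_int (a * m) = rat_of_int (n * b)" using x assms m by (simp add: field_simps)
  then have "a * m = n * b" by linarith
  then have "multiplicity (int p) (a * m) = multiplicity (int p) (n * b)" by simp
  then have "multiplicity (int p) a + multiplicity (int p) m =
      multiplicity (int p) n + multiplicity (int p) b"
    using assms m n prime_elem_p by (simp add: prime_elem_multiplicity_mult_distrib)
  then show ?thesis by (simp add: padic_val_def q)
qed

lemma rat_frac_cases: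
  fixes x :: rat
  obtains a b where "b \<noteq> 0" "x = of_int a / of_int b" "x \<noteq> 0 \<Longrightarrow> a \<noteq> 0"
proof -
  obtain a b where q: "quotient_of x = (a, b)" by (cases "quotient_of x")
  show thesis
    using quotient_of_div[OF q] quotient_of_denom_pos[OF q] by (intro that[of b a]) auto
qed

lemma padic_val_mult:
  assumes "x \<noteq> 0" "y \<noteq> 0"
  shows "padic_val p (x * y) = padic_val p x + padic_val p y"
proof -
  obtain a b where ab: "b \<noteq> 0" "x = of_int a / of_int b" "a \<noteq> 0"
    using rat_frac_cases[of x] assms by metis
  obtain c d where cd: "d \<noteq> 0" "y = of_int c / of_int d" "c \<noteq> 0"
    using rat_frac_cases[of y] assms by metis
  have "x * y = of_int (a * c) / of_int (b * d)" by (simp add: ab cd)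
  then show ?thesis
    using ab cd prime_elem_p padic_val_frac[of "a * c" "b * d"]
    by (simp add: padic_val_frac prime_elem_multiplicity_mult_distrib)
qed

lemma padic_val_of_int: "a \<noteq> 0 \<Longrightarrow> padic_val p (of_int a) = int (multiplicity (int p) a)"
  using padic_val_frac[of a 1] by simp

lemma padic_val_1 [simp]: "padic_val p 1 = 0"
  using padic_val_of_int[of 1] by simp

lemma padic_val_minus: "padic_val p (- x) = padic_val p x"
proof (cases "x = 0")
  case False
  have "padic_val p (- 1) = 0" using padic_val_of_int[of "-1"] by simp
  then show ?thesis using padic_val_mult[of "-1" x] False by simp
qed simp

lemma padic_val_divide:
  assumes "x \<noteq> 0" "y \<noteq> 0"
  shows "padic_val p (x / y) = padic_val p x - padic_val p y"
  using padic_val_mult[of "x / y" y] assms by simp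

lemma padic_val_add:
  assumes "x \<noteq> 0" "y \<noteq> 0" "x + y \<noteq> 0" and v: "v \<le> padic_val p x" "v \<le> padic_val p y"
  shows "v \<le> padic_val p (x + y)"
proof -
  obtain a b where ab: "b \<noteq> 0" "x = of_int a / of_int b" "a \<noteq> 0"
    using rat_frac_cases[of x] assms by metis
  obtain c d where cd: "d \<noteq> 0" "y = of_int c / of_int d" "c \<noteq> 0"
    using rat_frac_cases[of y] assms by metis
  have xd: "x = of_int (a * d) / of_int (b * d)" and yd: "y = of_int (c * b) / of_int (b * d)"
    using ab cd by simp_all
  have xy: "x + y = of_int (a * d + c * b) / of_int (b * d)"
    unfolding xd yd by (simp add: add_divide_distrib)
  have nz: "a * d + c * b \<noteq> 0"
  proof
    assume "a * d + c * b = 0"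
    then show False using xy assms(3) by (simp only: of_int_0 div_0)
  qed
  \<comment> \<open>\<open>e\<close> is the bound carried over to the common denominator
    \<open>b * d\<close>; a negative bound is cut off at 0, where divisibility is trivial.\<close>
  define e where "e = nat (v + int (multiplicity (int p) (b * d)))"
  have "e \<le> multiplicity (int p) (a * d)" "e \<le> multiplicity (int p) (c * b)"
    using v ab cd padic_val_frac[of "a * d" "b * d"] padic_val_frac[of "c * b" "b * d"]
    unfolding xd yd e_def by (simp_all del: of_int_mult)
  then have "int p ^ e dvd a * d" "int p ^ e dvd c * b" by (simp_all add: multiplicity_dvd')
  then have "int p ^ e dvd a * d + c * b" by simp
  then have "e \<le> multiplicity (int p) (a * d + c * b)"
    using nz not_unit_p by (intro multiplicity_geI) auto
  then show ?thesis
    using padic_val_frac[OF nz, of "b * d"] ab cd unfolding xy e_def by (simp del: of_int_mult of_int_add)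
qed

text \<open>A lower bound for the valuation, in units of \<open>1 / (p - 1)\<close>.\<close>

definition ord_ge :: "int \<Rightarrow> rat \<Rightarrow> bool"
  where "ord_ge s x \<longleftrightarrow> x = 0 \<or> s \<le> (int p - 1) * padic_val p x"

lemma ord_ge_0 [simp]: "ord_ge s 0"
  by (simp add: ord_ge_def)

lemma ord_ge_mono: "ord_ge s x \<Longrightarrow> s' \<le> s \<Longrightarrow> ord_ge s' x"
  by (auto simp: ord_ge_def)

lemma ord_ge_minus [simp]: "ord_ge s (- x) \<longleftrightarrow> ord_ge s x"
  by (simp add: ord_ge_def padic_val_minus)

lemma ord_ge_add:
  assumes "ord_ge s x" "ord_ge s y"
  shows "ord_ge s (x + y)"
proof (cases "x = 0 \<or> y = 0 \<or> x + y = 0")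
  case False
  define v where "v = min (padic_val p x) (padic_val p y)"
  have "s \<le> (int p - 1) * v" using assms False by (auto simp: ord_ge_def v_def min_def)
  also have "\<dots> \<le> (int p - 1) * padic_val p (x + y)"
    using False p2 by (intro mult_left_mono padic_val_add) (auto simp: v_def)
  finally show ?thesis by (simp add: ord_ge_def)
qed (use assms in auto)

lemma ord_ge_sum: "(\<And>i. i \<in> A \<Longrightarrow> ord_ge s (f i)) \<Longrightarrow> ord_ge s (\<Sum>i\<in>A. f i)"
  by (induction A rule: infinite_finite_induct) (auto intro: ord_ge_add)

lemma ord_ge_mult: "ord_ge s x \<Longrightarrow> ord_ge t y \<Longrightarrow> ord_ge (s + t) (x * y)"
  by (cases "x = 0 \<or> y = 0") (auto simp: ord_ge_def padic_val_mult distrib_left intro: add_mono)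

lemma ord_ge_of_int [simp]: "ord_ge 0 (of_int a)"
  using p2 by (cases "a = 0") (simp_all add: ord_ge_def padic_val_of_int)

lemma ord_ge_1 [simp]: "ord_ge 0 1"
  using ord_ge_of_int[of 1] by simp

lemma ord_ge_power: "ord_ge s x \<Longrightarrow> ord_ge (int n * s) (x ^ n)"
proof (induction n)
  case (Suc n)
  then show ?case using ord_ge_mult[of s x "int n * s" "x ^ n"] by (simp add: algebra_simps)
qed simp

text \<open>Subtracting 1 turns the trailing zeros, as many as the multiplicity, into digits
  \<open>p - 1\<close> and lowers the next digit by one. Summed over \<open>m\<close>, this is
  Legendre's formula.\<close>

lemma digit_sum_multiplicity:
  "0 < m \<Longrightarrow> \<sigma> m + (p - 1) * multiplicity p m = Suc (\<sigma> (m - 1))"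
proof (induction m rule: less_induct)
  case (less m)
  show ?case
  proof (cases "p dvd m")
    case True
    then obtain a where m: "m = p * a" by blast
    with less have a: "0 < a" "a < m" using p2 by auto
    have "m - 1 = p * (a - 1) + (p - 1)" using a p2 unfolding m by (cases a) auto
    moreover have "\<sigma> (p * (a - 1) + (p - 1)) = \<sigma> (a - 1) + (p - 1)"
      using p2 by (intro digit_sum_mult_add) simp
    ultimately have "\<sigma> (m - 1) = \<sigma> (a - 1) + (p - 1)" by (simp only:)
    moreover have "multiplicity p m = Suc (multiplicity p a)"
      unfolding m using a p2 by (intro multiplicity_times_same) auto
    ultimately show ?thesis using less.IH[OF a(2,1)] by (simp add: m)
  next
    case False
    then have c: "0 < m mod p" by (simp add: dvd_eq_mod_eq_0)
    have "m - 1 = p * (m div p) + (m mod p - 1)" using c by (simp flip: div_mult_mod_eq)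
    moreover have "m mod p - 1 < p" using p2 by (simp add: less_imp_diff_less)
    ultimately have "\<sigma> (m - 1) = \<sigma> (m div p) + (m mod p - 1)"
      using digit_sum_mult_add by metis
    moreover have "\<sigma> m = m mod p + \<sigma> (m div p)" by (rule digit_sum_rec)
    ultimately show ?thesis using c False by (simp add: not_dvd_imp_multiplicity_0)
  qed
qed

lemma digit_sum_fact: "(p - 1) * multiplicity p (fact n :: nat) + \<sigma> n = n"
proof (induction n)
  case (Suc n)
  have mf: "multiplicity p (fact (Suc n) :: nat) = multiplicity p (Suc n) + multiplicity p (fact n :: nat)"
    unfolding fact_Suc of_nat_id
    using prime_p by (intro prime_elem_multiplicity_mult_distrib) auto
  have "\<sigma> (Suc n) + (p - 1) * multiplicity p (Suc n) = Suc (\<sigma> n)"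
    using digit_sum_multiplicity[of "Suc n"] by simp
  then show ?case using Suc.IH unfolding mf add_mult_distrib2 by linarith
qed simp

lemma padic_val_fact: "(int p - 1) * padic_val p (fact n) = int n - int (\<sigma> n)"
proof -
  have "int ((p - 1) * multiplicity p (fact n :: nat) + \<sigma> n) = int n"
    by (simp only: digit_sum_fact)
  moreover have "padic_val p (fact n) = int (multiplicity p (fact n :: nat))"
    using padic_val_of_nat[of p "fact n"] by simp
  ultimately show ?thesis using p2 by (simp add: of_nat_diff)
qed

lemma ord_ge_fact: "ord_ge (int n - int (\<sigma> n)) (fact n)"
  by (simp add: ord_ge_def padic_val_fact)

lemma ord_ge_inverse_fact: "ord_ge (int (\<sigma> n) - int n) (1 / fact n)"
  using padic_val_fact[of n] padic_val_divide[of 1 "fact n"] by (simp add: ord_ge_def)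

lemma gap_multiplicity: "gap i + (p - 1) * multiplicity p (Suc i) = i"
  using gap_add[of i] digit_sum_multiplicity[of "Suc i"] by simp

lemma ord_ge_inverse_Suc: "ord_ge (int (gap i) - int i) ((- 1) ^ n / of_nat (Suc i))"
proof -
  have "padic_val p (1 / of_nat (Suc i)) = - int (multiplicity p (Suc i))"
    using padic_val_divide[of 1 "of_nat (Suc i)"] padic_val_of_nat[of p "Suc i"] by simp
  moreover have "int (gap i + (p - 1) * multiplicity p (Suc i)) = int i"
    by (simp only: gap_multiplicity)
  ultimately have "ord_ge (int (gap i) - int i) (1 / of_nat (Suc i))"
    using p2 by (simp add: ord_ge_def of_nat_diff)
  then show ?thesis by (cases "even n") simp_all
qed

lemma ord_ge_ln_coeff: "ord_ge (int (gap i) - int i) (ln_coeff i)"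
  by (simp only: ln_coeff_def ord_ge_minus ord_ge_inverse_Suc)

section \<open>Valuations of the terms of the expansion\<close>

text \<open>The shape \<open>t - (j + w)\<close> is stable under splitting off \<open>u\<close>
  factors of index \<open>i\<close>: their cost comes off \<open>t\<close>, their number off
  \<open>j\<close> and their weight off \<open>w\<close>.\<close>

lemma ord_ge_monomial_mult:
  assumes "i * u \<le> w" "u \<le> j"
    and F: "ord_ge (t - int (gap i * u + \<sigma> u) - int (j - u + (w - i * u))) F"
  shows "ord_ge (t - int (j + w)) (ln_coeff i ^ u / fact u * F)"
proof -
  have "ord_ge (int u * (int (gap i) - int i) + (int (\<sigma> u) - int u)) (ln_coeff i ^ u * (1 / fact u))"
    by (intro ord_ge_mult ord_ge_power ord_ge_ln_coeff ord_ge_inverse_fact)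
  then have "ord_ge (int u * (int (gap i) - int i) + (int (\<sigma> u) - int u)) (ln_coeff i ^ u / fact u)"
    by simp
  from ord_ge_mult[OF this F] show ?thesis
    by (rule ord_ge_mono) (use assms in \<open>simp_all add: of_nat_diff algebra_simps\<close>)
qed

text \<open>\<open>t\<close> is any common lower bound of the costs, so that it can be shifted by
  the cost of the factors split off in the induction over \<open>I\<close>. If nothing reaches
  \<open>j\<close> and \<open>w\<close>, every \<open>t\<close> is allowed, which fits a vanishing
  coefficient.\<close>

lemma ord_ge_ln_part:
  assumes "finite I" "0 \<notin> I" "\<And>Q. reach j w Q \<Longrightarrow> t \<le> int Q"
  shows "ord_ge (t - int (j + w)) (fps_nth (ln_part I ^ j) w / fact j)"
  using assms
proof (induction I arbitrary: j w t rule: finite_induct)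
  case empty
  show ?case
  proof (cases "j = 0 \<and> w = 0")
    case True
    then have "t \<le> 0" using empty.prems(2)[of 0] reach_0 by simp
    then show ?thesis using True ord_ge_mono[OF ord_ge_1] by simp
  next
    case False
    then show ?thesis by (cases j) (auto simp: ln_part_def)
  qed
next
  case (insert i I)
  have "ord_ge (t - int (j + w)) (ln_coeff i ^ u / fact u *
      (fps_nth (ln_part I ^ (j - u)) (w - i * u) / fact (j - u)))" if u: "u \<le> j" "\<not> w < i * u" for u
  proof (rule ord_ge_monomial_mult)
    show "ord_ge (t - int (gap i * u + \<sigma> u) - int (j - u + (w - i * u)))
        (fps_nth (ln_part I ^ (j - u)) (w - i * u) / fact (j - u))"
    proof (rule insert.IH)
      fix Q assume "reach (j - u) (w - i * u) Q"
      from reach_add[OF this, of i u] insert.prems(1) u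
      have "reach j w (Q + gap i * u + \<sigma> u)" by (cases i) auto
      then show "t - int (gap i * u + \<sigma> u) \<le> int Q" using insert.prems(2) by fastforce
    qed (use insert.prems in auto)
  qed (use u in auto)
  then show ?case
    unfolding ln_part_insert[OF insert.hyps(1,2)] fps_nth_power_add_monomial
    by (intro ord_ge_sum) auto
qed

text \<open>Keeping \<open>p - 1\<close> in the base set makes the difference 0 for empty
  \<open>I\<close>. A new index \<open>i\<close> reproduces the old difference in the term
  \<open>u = 0\<close>, and all its other terms really use \<open>i\<close>.\<close>

lemma ord_ge_ln_part_diff:
  assumes "finite I" "0 \<notin> I" "p - 1 \<notin> I" "\<And>Q. reach_other j w Q \<Longrightarrow> t \<le> int Q"
  shows "ord_ge (t - int (j + w)) ((fps_nth (ln_part (insert (p - 1) I) ^ j) w -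
    fps_nth ((fps_const (ln_coeff (p - 1)) * fps_X ^ (p - 1)) ^ j) w) / fact j)"
  using assms
proof (induction I rule: finite_induct)
  case empty
  then show ?case by (simp add: ln_part_def)
next
  case (insert i I)
  let ?I = "insert (p - 1) I"
  let ?m = "fps_nth ((fps_const (ln_coeff (p - 1)) * fps_X ^ (p - 1)) ^ j) w"
  define f where "f u = (if w < i * u then 0 else ln_coeff i ^ u / fact u *
      (fps_nth (ln_part ?I ^ (j - u)) (w - i * u) / fact (j - u)))" for u
  have i: "1 \<le> i" "i \<noteq> p - 1" using insert.prems by (auto simp: Suc_le_eq)
  have f: "ord_ge (t - int (j + w)) (f u)" if u: "u \<le> j" "1 \<le> u" for u
  proof (cases "w < i * u")
    case False
    have "ord_ge (t - int (j + w)) (ln_coeff i ^ u / fact u *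
        (fps_nth (ln_part ?I ^ (j - u)) (w - i * u) / fact (j - u)))"
    proof (rule ord_ge_monomial_mult)
      show "ord_ge (t - int (gap i * u + \<sigma> u) - int (j - u + (w - i * u)))
          (fps_nth (ln_part ?I ^ (j - u)) (w - i * u) / fact (j - u))"
      proof (rule ord_ge_ln_part)
        fix Q assume "reach (j - u) (w - i * u) Q"
        from reach_other.intros[OF this i u(2)] u False
        have "reach_other j w (Q + gap i * u + \<sigma> u)" by simp
        then show "t - int (gap i * u + \<sigma> u) \<le> int Q" using insert.prems(3) by fastforce
      qed (use insert p2 in auto)
    qed (use u False in auto)
    then show ?thesis using False by (simp add: f_def)
  qed (simp add: f_def)
  have "fps_nth (ln_part (insert (p - 1) (insert i I)) ^ j) w / fact j
      = fps_nth (ln_part (insert i ?I) ^ j) w / fact j"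
    by (simp add: insert_commute)
  also have "ln_part (insert i ?I) = fps_const (ln_coeff i) * fps_X ^ i + ln_part ?I"
    using insert.hyps i by (intro ln_part_insert) auto
  also have "fps_nth (\<dots> ^ j) w / fact j = (\<Sum>u\<le>j. f u)"
    by (simp only: fps_nth_power_add_monomial f_def)
  also have "\<dots> = f 0 + (\<Sum>u<j. f (Suc u))" by (rule sum.atMost_shift)
  also have "f 0 = fps_nth (ln_part ?I ^ j) w / fact j" by (simp add: f_def)
  finally have "(fps_nth (ln_part (insert (p - 1) (insert i I)) ^ j) w - ?m) / fact j =
      (fps_nth (ln_part ?I ^ j) w - ?m) / fact j + (\<Sum>u<j. f (Suc u))"
    by (simp add: diff_divide_distrib)
  moreover have "ord_ge (t - int (j + w)) ((fps_nth (ln_part ?I ^ j) w - ?m) / fact j)"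
    using insert.prems by (intro insert.IH) auto
  moreover have "ord_ge (t - int (j + w)) (\<Sum>u<j. f (Suc u))"
    by (intro ord_ge_sum f) auto
  ultimately show ?case by (simp only: ord_ge_add)
qed

lemma ord_ge_ln_weight: "ord_ge (int (\<sigma> w) - int w) (fps_nth (ln_weight e) w)"
proof -
  obtain a :: int where "fact w * fps_nth (ln_weight e) w = of_int a"
    using fps_nth_ln_weight_int by blast
  then have "fps_nth (ln_weight e) w = of_int a * (1 / fact w)" by (simp add: field_simps)
  then show ?thesis
    using ord_ge_mult[OF ord_ge_of_int[of a] ord_ge_inverse_fact[of w]] by simp
qed

lemma ord_ge_ln_weight_0: "ord_ge 0 (fps_nth (ln_weight 0) w)"
  using ord_ge_of_int[of "(- 1) ^ w"] by (simp add: fps_nth_ln_weight_0)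

lemma ord_ge_Stirling:
  assumes "e + k \<le> n"
    and H: "\<And>j w w' Q. w + w' + k = n \<Longrightarrow> reach j w Q \<Longrightarrow> \<sigma> (n + j) \<le> S + Q + \<sigma> w'"
  shows "ord_ge (int k - int S) (of_nat (n choose e) * (fact k * of_nat (Stirling (n - e) k)))"
  unfolding binomial_Stirling_expansion[OF assms(1)] sum_distrib_left
proof (intro ord_ge_sum)
  fix w j assume w: "w \<in> {..n - k}"
  define w' where "w' = n - k - w"
  have n: "w + w' + k = n" using w assms by (simp add: w'_def)
  have "ord_ge (int (\<sigma> (n + j)) - int S - int (\<sigma> w') - int (j + w))
      (fps_nth ((1 - ln_quot) ^ j) w / fact j)"
    unfolding fps_nth_one_minus_ln_quot_power[OF order_refl]
  proof (rule ord_ge_ln_part)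
    fix Q assume "reach j w Q"
    from H[OF n this] show "int (\<sigma> (n + j)) - int S - int (\<sigma> w') \<le> int Q" by linarith
  qed auto
  from ord_ge_mult[OF ord_ge_ln_weight[of w' e] ord_ge_mult[OF ord_ge_fact[of "n + j"] this]]
  show "ord_ge (int k - int S) (fps_nth (ln_weight e) (n - k - w) *
      (fact (n + j) * (fps_nth ((1 - ln_quot) ^ j) w / fact j)))"
    unfolding w'_def[symmetric] by (rule ord_ge_mono) (use n in linarith)
qed

text \<open>The term of the expansion in which only \<open>z ^ (p - 1)\<close> is used.\<close>

definition main_term :: "nat \<Rightarrow> nat \<Rightarrow> rat"
  where "main_term n J = fact (n + J) * (ln_coeff (p - 1) ^ J / fact J)"

text \<open>The summand \<open>+ 1\<close> expresses strictness. Terms with \<open>w' > 0\<close>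
  are small because \<open>ln_weight 0\<close> has integral coefficients; for \<open>w' = 0\<close>
  the power of the pure monomial of index \<open>p - 1\<close> is subtracted, and what remains uses
  another index.\<close>

lemma ord_ge_Stirling_diff_main_term:
  assumes n: "n = k + (p - 1) * J"
    and H: "\<And>j w w' Q. w + w' + k = n \<Longrightarrow> reach j w Q \<and> 0 < w' \<or> reach_other j w Q \<Longrightarrow>
      \<sigma> (n + j) < S + Q + w'"
  shows "ord_ge (int k - int S + 1) (fact k * of_nat (Stirling n k) - main_term n J)"
proof -
  define F where "F w j = fact (n + j) * (fps_nth ((1 - ln_quot) ^ j) w / fact j)" for w j
  \<comment> \<open>The contribution of index \<open>p - 1\<close> alone; since
    \<open>n - k = (p - 1) * J\<close>, it vanishes unless \<open>j = J\<close>.\<close>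
  define G where "G j = fact (n + j) *
    (fps_nth ((fps_const (ln_coeff (p - 1)) * fps_X ^ (p - 1)) ^ j) (n - k) / fact j)" for j
  have "fps_nth ((fps_const (ln_coeff (p - 1)) * fps_X ^ (p - 1)) ^ j) (n - k) =
      (if j = J then ln_coeff (p - 1) ^ j else 0)" for j
  proof -
    have eq: "(fps_const (ln_coeff (p - 1)) * fps_X ^ (p - 1)) ^ j =
        fps_const (ln_coeff (p - 1) ^ j) * fps_X ^ ((p - 1) * j)"
      by (simp only: power_mult_distrib power_mult fps_const_power)
    have "n - k = (p - 1) * j \<longleftrightarrow> j = J" using p2 n by auto
    then show ?thesis unfolding eq fps_mult_left_const_nth fps_X_power_nth by simp
  qed
  then have "G j = (if j = J then main_term n J else 0)" for j
    by (simp add: G_def main_term_def)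
  moreover have "J \<le> n - k"
    using n p2 by (cases "p - 1") auto
  ultimately have D: "main_term n J = (\<Sum>j\<le>n - k. G j)" by simp
  have "fact k * of_nat (Stirling n k) =
      (\<Sum>w\<le>n - k. fps_nth (ln_weight 0) (n - k - w) * (\<Sum>j\<le>w. F w j))"
    using binomial_Stirling_expansion[of 0 k n] n by (simp add: F_def)
  also have "\<dots> = (\<Sum>w<n - k. fps_nth (ln_weight 0) (n - k - w) * (\<Sum>j\<le>w. F w j))
      + (\<Sum>j\<le>n - k. F (n - k) j)"
    by (simp add: lessThan_Suc_atMost[symmetric] fps_nth_ln_weight_0)
  finally have eq: "fact k * of_nat (Stirling n k) - main_term n J =
      (\<Sum>w<n - k. \<Sum>j\<le>w. fps_nth (ln_weight 0) (n - k - w) * F w j)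
      + (\<Sum>j\<le>n - k. F (n - k) j - G j)"
    by (simp add: D sum_subtractf sum_distrib_left)
  have 1: "ord_ge (int k - int S + 1) (fps_nth (ln_weight 0) (n - k - w) * F w j)"
    if w: "w < n - k" for w j
  proof -
    define w' where "w' = n - k - w"
    have n': "w + w' + k = n" "0 < w'" using w by (auto simp: w'_def)
    have "ord_ge (int (\<sigma> (n + j)) + 1 - int S - int w' - int (j + w))
        (fps_nth ((1 - ln_quot) ^ j) w / fact j)"
      unfolding fps_nth_one_minus_ln_quot_power[OF order_refl]
    proof (rule ord_ge_ln_part)
      fix Q assume "reach j w Q"
      then have "\<sigma> (n + j) < S + Q + w'" using H n' by blast
      then show "int (\<sigma> (n + j)) + 1 - int S - int w' \<le> int Q" by linarith
    qed auto
    from ord_ge_mult[OF ord_ge_ln_weight_0[of w'] ord_ge_mult[OF ord_ge_fact[of "n + j"] this]]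
    show ?thesis unfolding w'_def[symmetric] F_def by (rule ord_ge_mono) (use n' in linarith)
  qed
  have 2: "ord_ge (int k - int S + 1) (F (n - k) j - G j)" for j
  proof -
    \<comment> \<open>The maximum guarantees that \<open>p - 1\<close> lies in the range even when
      \<open>n - k\<close> is smaller; indices beyond \<open>n - k\<close> do not affect the
      coefficient.\<close>
    define I where "I = {1..max (n - k) (p - 1)} - {p - 1}"
    have I: "insert (p - 1) I = {1..max (n - k) (p - 1)}" using p2 by (auto simp: I_def)
    have n': "(n - k) + 0 + k = n" using n by simp
    have D: "ord_ge (int (\<sigma> (n + j)) + 1 - int S - int (j + (n - k)))
        ((fps_nth (ln_part (insert (p - 1) I) ^ j) (n - k) -
          fps_nth ((fps_const (ln_coeff (p - 1)) * fps_X ^ (p - 1)) ^ j) (n - k)) / fact j)"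
    proof (rule ord_ge_ln_part_diff)
      fix Q assume "reach_other j (n - k) Q"
      then have "\<sigma> (n + j) < S + Q + 0" using H[OF n'] by blast
      then show "int (\<sigma> (n + j)) + 1 - int S \<le> int Q" by linarith
    qed (auto simp: I_def)
    have "fps_nth ((1 - ln_quot) ^ j) (n - k) = fps_nth (ln_part (insert (p - 1) I) ^ j) (n - k)"
      unfolding I by (rule fps_nth_one_minus_ln_quot_power) simp
    then have "F (n - k) j - G j = fact (n + j) *
        ((fps_nth (ln_part (insert (p - 1) I) ^ j) (n - k) -
          fps_nth ((fps_const (ln_coeff (p - 1)) * fps_X ^ (p - 1)) ^ j) (n - k)) / fact j)"
      by (simp only: F_def G_def right_diff_distrib diff_divide_distrib)
    with ord_ge_mult[OF ord_ge_fact[of "n + j"] D]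
    have "ord_ge (int (n + j) - int (\<sigma> (n + j)) +
        (int (\<sigma> (n + j)) + 1 - int S - int (j + (n - k)))) (F (n - k) j - G j)"
      by (simp only:)
    then show ?thesis by (rule ord_ge_mono) (use n' in linarith)
  qed
  show ?thesis unfolding eq by (intro ord_ge_add ord_ge_sum 1 2) auto
qed

lemma main_term_nonzero: "main_term n J \<noteq> 0"
  by (simp add: main_term_def ln_coeff_def del: of_nat_Suc)

lemma padic_val_main_term:
  assumes "n = k + (p - 1) * J"
  shows "(int p - 1) * padic_val p (main_term n J) = int k + int (\<sigma> J) - int (\<sigma> (n + J))"
proof -
  have nz: "ln_coeff (p - 1) \<noteq> 0" by (simp add: ln_coeff_def del: of_nat_Suc)
  have "padic_val p (ln_coeff (p - 1)) = - 1"
  proof -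
    have "ln_coeff (p - 1) = 1 / of_nat p \<or> ln_coeff (p - 1) = - (1 / of_nat p)"
      using p2 by (cases "even (p - 1)") (auto simp: ln_coeff_def)
    moreover have "padic_val p (1 / of_nat p) = - 1"
      using p2 padic_val_divide[of 1 "of_nat p"] padic_val_of_nat[of p p]
      by (simp add: multiplicity_self)
    ultimately show ?thesis using padic_val_minus by metis
  qed
  then have "padic_val p (ln_coeff (p - 1) ^ J) = - int J"
  proof (induction J)
    case (Suc J)
    then show ?case using nz padic_val_mult[of "ln_coeff (p - 1)" "ln_coeff (p - 1) ^ J"] by simp
  qed simp
  then have "padic_val p (main_term n J) = padic_val p (fact (n + J)) - int J - padic_val p (fact J)"
    unfolding main_term_def using nz by (simp add: padic_val_mult padic_val_divide)
  then have "(int p - 1) * padic_val p (main_term n J) =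
      (int p - 1) * padic_val p (fact (n + J)) - (int p - 1) * int J - (int p - 1) * padic_val p (fact J)"
    by (simp add: right_diff_distrib)
  also have "\<dots> = int (n + J) - int (\<sigma> (n + J)) - (int p - 1) * int J - (int J - int (\<sigma> J))"
    unfolding padic_val_fact ..
  also have "int n = int k + (int p - 1) * int J" using assms p2 by (simp add: of_nat_diff)
  then have "int (n + J) - int (\<sigma> (n + J)) - (int p - 1) * int J - (int J - int (\<sigma> J))
      = int k + int (\<sigma> J) - int (\<sigma> (n + J))" by simp
  finally show ?thesis .
qed

section \<open>From the minimum zero case of \<open>B\<close> to \<open>T + B\<close>\<close>

lemma padic_val_fact_mult_Stirling:
  assumes "Stirling n k \<noteq> 0"
  shows "(int p - 1) * padic_val p (fact k * of_nat (Stirling n k)) =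
    int k - int (\<sigma> k) + (int p - 1) * int (multiplicity p (Stirling n k))"
  using assms by (simp add: padic_val_mult padic_val_of_nat distrib_left padic_val_fact)

lemma MZC_iff:
  "MZC p n k \<longleftrightarrow> Stirling n k \<noteq> 0 \<and>
    (int p - 1) * int (multiplicity p (Stirling n k)) = int (\<sigma> k) - int (\<sigma> n)"
proof -
  have "rat_of_nat (multiplicity p (Stirling n k)) =
      (rat_of_nat (\<sigma> k) - rat_of_nat (\<sigma> n)) / (rat_of_nat p - 1) \<longleftrightarrow>
    rat_of_int ((int p - 1) * int (multiplicity p (Stirling n k))) =
      rat_of_int (int (\<sigma> k) - int (\<sigma> n))"
    using p2 by (simp add: field_simps)
  then show ?thesis unfolding MZC_def of_int_eq_iff by blast
qed

text \<open>The hypothesis fixes the scaled valuation of \<open>k! S(B, k)\<close> at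
  \<open>k - \<sigma> B\<close>. All terms but the main one exceed this value, so the main term
  cannot; a carry in \<open>B + d\<close> would make it do so.\<close>

lemma MZC_obtain:
  assumes "MZC p B k" "k \<le> B"
  obtains d where "B = k + (p - 1) * d" "\<sigma> (B + d) = \<sigma> B + \<sigma> d"
proof -
  have M: "Stirling B k \<noteq> 0"
      "(int p - 1) * int (multiplicity p (Stirling B k)) = int (\<sigma> k) - int (\<sigma> B)"
    using assms MZC_iff by auto
  \<comment> \<open>Integrality of the valuation makes \<open>\<sigma> k - \<sigma> B\<close> a
    multiple of \<open>p - 1\<close>, and digit sums are congruent to their numbers. This is what
    makes a main term exist.\<close>
  have "p - 1 dvd B - k"
  proof -
    obtain z z' where z: "B = \<sigma> B + (p - 1) * z" "k = \<sigma> k + (p - 1) * z'"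
      using digit_sum_cong by meson
    have p1: "int (p - 1) = int p - 1" using p2 by simp
    have "int B = int (\<sigma> B) + (int p - 1) * int z" "int k = int (\<sigma> k) + (int p - 1) * int z'"
      using arg_cong[OF z(1), of int] arg_cong[OF z(2), of int]
      unfolding of_nat_add of_nat_mult p1 by auto
    then have "int (B - k) = (int p - 1) * (int z - int z' - int (multiplicity p (Stirling B k)))"
      using M(2) assms(2) by (simp add: of_nat_diff algebra_simps)
    then have "int (p - 1) dvd int (B - k)" unfolding p1 by simp
    then show ?thesis by (simp only: of_nat_dvd_iff)
  qed
  then obtain d where d: "B = k + (p - 1) * d" using assms(2) by (metis dvdE le_add_diff_inverse)
  define x where "x = (fact k * of_nat (Stirling B k) :: rat)"
  have x: "x \<noteq> 0" "(int p - 1) * padic_val p x = int k - int (\<sigma> B)"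
    using M padic_val_fact_mult_Stirling[OF M(1)] by (simp_all add: x_def)
  have diff: "ord_ge (int k - int (\<sigma> B) + 1) (x - main_term B d)"
    unfolding x_def
  proof (rule ord_ge_Stirling_diff_main_term[OF d])
    fix j w w' Q :: nat
    assume "reach j w Q \<and> 0 < w' \<or> reach_other j w Q"
    then show "\<sigma> (B + j) < \<sigma> B + Q + w'"
      using digit_sum_add_le[of B j] digit_sum_le_reach[of j w Q]
        digit_sum_less_reach_other[of j w Q] by linarith
  qed
  have "\<sigma> (B + d) = \<sigma> B + \<sigma> d"
  proof (rule ccontr)
    assume "\<sigma> (B + d) \<noteq> \<sigma> B + \<sigma> d"
    then have "\<sigma> (B + d) < \<sigma> B + \<sigma> d" using digit_sum_add_le[of B d] by simp
    then have "ord_ge (int k - int (\<sigma> B) + 1) (main_term B d)"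
      unfolding ord_ge_def padic_val_main_term[OF d] by simp
    from ord_ge_add[OF diff this] have "ord_ge (int k - int (\<sigma> B) + 1) x" by simp
    then show False using x by (simp add: ord_ge_def)
  qed
  with d show thesis by (rule that)
qed

lemma MZC_shift:
  assumes "1 \<le> k" "k \<le> B" "MZC p B k" and N: "p ^ N \<le> B" "B < p ^ Suc N"
    and T: "T = (p - 1) * (p ^ N * t)"
  shows "Stirling (T + B) k \<noteq> 0"
    and "(int p - 1) * int (multiplicity p (Stirling (T + B) k)) = int (\<sigma> k) - int (\<sigma> B)"
    and "e + k \<le> T + B \<Longrightarrow> ord_ge (int k - int (\<sigma> B))
      (of_nat (T + B choose e) * (fact k * of_nat (Stirling (T + B - e) k)))"
proof -
  obtain d where d: "B = k + (p - 1) * d" "\<sigma> (B + d) = \<sigma> B + \<sigma> d"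
    using MZC_obtain[OF assms(3,2)] .
  have pd: "(p - 1) * d + d = p * d" using p2 by (cases p) auto
  \<comment> \<open>Reaching \<open>p ^ Suc N\<close> would need a carry. As
    \<open>p * d \<le> B + d\<close>, the bound passes on to \<open>d < p ^ N\<close>.\<close>
  have Bd: "B + d < p ^ Suc N"
  proof (rule ccontr)
    assume "\<not> B + d < p ^ Suc N"
    moreover have "d < p ^ Suc N"
    proof -
      have "1 * d \<le> (p - 1) * d" using p2 by (intro mult_le_mono1) simp
      then show ?thesis using d N by linarith
    qed
    ultimately have "\<sigma> (B + d) + (p - 1) \<le> \<sigma> B + \<sigma> d"
      using N by (intro digit_sum_carry[of B "Suc N" d]) auto
    then show False using d p2 by simp
  qed
  have "p * d < p ^ Suc N" using Bd d(1) pd by linarith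
  then have dN: "d < p ^ N" using p2 by simp
  define n J where "n = T + B" and "J = p ^ N * t + d"
  have n: "n = k + (p - 1) * J"
    unfolding n_def J_def T add_mult_distrib2 using d by simp
  have n': "B + (p - 1) * (p ^ N * t) = n" by (simp add: n_def T)
  have k: "0 < k" using assms by simp
  show ord: "ord_ge (int k - int (\<sigma> B))
      (of_nat (T + B choose e) * (fact k * of_nat (Stirling (T + B - e) k)))" if "e + k \<le> T + B" for e
    using that reach_le[OF N d(1) k dN, of _ _ t] unfolding n' unfolding n_def[symmetric]
    by (intro ord_ge_Stirling) auto
  define x where "x = (fact k * of_nat (Stirling n k) :: rat)"
  have ge: "ord_ge (int k - int (\<sigma> B)) x"
    using ord[of 0] assms by (simp add: x_def n_def)
  have diff: "ord_ge (int k - int (\<sigma> B) + 1) (x - main_term n J)"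
    unfolding x_def
    using reach_less[OF N d(1) k dN, of _ _ t] unfolding n'
    by (intro ord_ge_Stirling_diff_main_term[OF n]) auto
  \<comment> \<open>In \<open>n + J\<close> the multiples of \<open>p ^ N * t\<close> merge into
    \<open>p ^ Suc N * t\<close>, clear of \<open>B + d\<close>. So \<open>t\<close> adds
    \<open>\<sigma> t\<close> to both digit sums in the valuation of the main term and
    cancels.\<close>
  have "p ^ N * t + (p - 1) * (p ^ N * t) = p ^ Suc N * t"
    using p2 by (cases p) (auto simp: algebra_simps)
  then have "n + J = p ^ Suc N * t + (B + d)" using n' by (simp add: J_def)
  then have "\<sigma> (n + J) = \<sigma> t + \<sigma> (B + d)" using digit_sum_add_power[OF Bd] by simp
  moreover have "\<sigma> J = \<sigma> t + \<sigma> d" unfolding J_def using dN by (rule digit_sum_add_power)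
  ultimately have main: "(int p - 1) * padic_val p (main_term n J) = int k - int (\<sigma> B)"
    unfolding padic_val_main_term[OF n] using d by simp
  have not_ge: "\<not> ord_ge (int k - int (\<sigma> B) + 1) x"
  proof
    assume "ord_ge (int k - int (\<sigma> B) + 1) x"
    from ord_ge_add[OF this, of "- (x - main_term n J)"] diff
    have "ord_ge (int k - int (\<sigma> B) + 1) (main_term n J)" by (simp only: ord_ge_minus) simp
    then show False using main main_term_nonzero by (simp add: ord_ge_def)
  qed
  then have "x \<noteq> 0" by auto
  then show S: "Stirling (T + B) k \<noteq> 0" by (simp add: x_def n_def)
  have "(int p - 1) * padic_val p x = int k - int (\<sigma> B)"
    using ge not_ge by (simp add: ord_ge_def)
  then show "(int p - 1) * int (multiplicity p (Stirling (T + B) k)) = int (\<sigma> k) - int (\<sigma> B)"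
    using padic_val_fact_mult_Stirling[OF S] by (simp add: x_def n_def)
qed

section \<open>The maximum pole\<close>

lemma max_pole_eqI:
  assumes "coeff f i \<noteq> 0" "\<And>j. coeff f j \<noteq> 0 \<Longrightarrow> padic_val p (coeff f i) \<le> padic_val p (coeff f j)"
  shows "max_pole p f = - padic_val p (coeff f i)"
proof -
  have "finite {i. coeff f i \<noteq> 0}"
    by (rule finite_subset[of _ "{..degree f}"]) (auto intro: le_degree)
  then have "Min ((\<lambda>i. padic_val p (coeff f i)) ` {i. coeff f i \<noteq> 0}) = padic_val p (coeff f i)"
    using assms by (intro Min_eqI) auto
  then show ?thesis by (simp add: max_pole_def)
qed

text \<open>The hypothesis makes the constant coefficient one of minimal valuation, so the maximum
  pole can be read off there; this coefficient is \<open>S(n, k)\<close> divided by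
  \<open>n choose k\<close>.\<close>

lemma AMZC_I:
  assumes k: "1 \<le> k" "k \<le> n" and S: "Stirling n k \<noteq> 0"
    and min: "\<And>e. e + k \<le> n \<Longrightarrow> ord_ge ((int p - 1) * padic_val p (fact k * of_nat (Stirling n k)))
      (of_nat (n choose e) * (fact k * of_nat (Stirling (n - e) k)))"
  shows "AMZC p n k"
proof -
  define f where "f = higher_bernoulli_poly (- int k) (n - k)"
  define c x where "c = (fact (n - k) / fact n :: rat)"
    and "x e = (of_nat (n choose e) * (fact k * of_nat (Stirling (n - e) k)) :: rat)" for e
  have f: "coeff f e = (if e \<le> n - k then c * x e else 0)" for e
    using coeff_higher_bernoulli_poly_Stirling[OF k, of e]
    by (auto simp: f_def c_def x_def coeff_higher_bernoulli_poly)
  have c: "c \<noteq> 0" by (simp add: c_def)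
  have x0: "x 0 = fact k * of_nat (Stirling n k)" by (simp add: x_def)
  have "max_pole p f = - padic_val p (coeff f 0)"
  proof (rule max_pole_eqI)
    show "coeff f 0 \<noteq> 0" using c S by (simp add: f x0)
    fix e assume nz: "coeff f e \<noteq> 0"
    then have e: "e + k \<le> n" "x e \<noteq> 0" using k by (auto simp: f split: if_splits)
    have "(int p - 1) * padic_val p (x 0) \<le> (int p - 1) * padic_val p (x e)"
      using min[OF e(1)] e(2) unfolding ord_ge_def x0[symmetric] x_def[of e, symmetric] by simp
    then have "padic_val p (x 0) \<le> padic_val p (x e)" using p2 by simp
    then show "padic_val p (coeff f 0) \<le> padic_val p (coeff f e)"
      using e c S k le_diff_conv2[of k n e] by (simp add: f padic_val_mult x0)
  qed
  also have "coeff f 0 = of_nat (Stirling n k) / of_nat (n choose k)"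
    using k by (simp add: f x0 c_def binomial_fact field_simps)
  also have "padic_val p \<dots> = int (multiplicity p (Stirling n k)) - int (multiplicity p (n choose k))"
    using S k by (simp add: padic_val_divide padic_val_of_nat)
  finally show ?thesis using k by (simp add: AMZC_def f_def)
qed

end

theorem theorem3p20:
  fixes p B k T :: nat
  assumes "prime p"
    and "1 \<le> k" and "k \<le> B"
    and "MZC p B k"
    and "(p - 1) dvd T"
    and "\<And>i j. digit p T i \<noteq> 0 \<Longrightarrow> digit p B j \<noteq> 0 \<Longrightarrow> p ^ j \<le> p ^ i"
    and "\<not> p dvd ((T + B) choose B)"
  shows "AMZC p (T + B) k \<and>
    rat_of_nat (multiplicity p (Stirling (T + B) k)) =
      (rat_of_nat (digit_sum p k) - rat_of_nat (digit_sum p B)) / (rat_of_nat p - 1)"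
proof -
  have p2: "2 \<le> p" using assms(1) by (rule prime_ge_2_nat)
  interpret prime_base p by unfold_locales (use assms(1) p2 in auto)
  have "1 \<le> B" using assms by simp
  then obtain N where N: "p ^ N \<le> B" "B < p ^ Suc N"
    using ex_power_ivl1[of p B] p2 by auto
  have "B div p ^ N \<noteq> 0" "B div p ^ N < p"
    using N p2 by (auto simp: div_eq_0_iff less_mult_imp_div_less)
  then have "digit p B N \<noteq> 0" by (simp add: digit_def)
  \<comment> \<open>Comparison with the leading digit of \<open>B\<close>, at position
    \<open>N\<close>, rules out nonzero digits of \<open>T\<close> below \<open>N\<close>.\<close>
  have "p ^ N dvd T"
  proof (rule power_dvd_if_low_digits_0, rule ccontr)
    fix i assume i: "i < N" and "digit p T i \<noteq> 0"
    then have "p ^ N \<le> p ^ i" using assms(6) \<open>digit p B N \<noteq> 0\<close> by blast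
    moreover have "p ^ i < p ^ N" using i p2 by (intro power_strict_increasing) auto
    ultimately show False by simp
  qed
  obtain T' where T': "T = (p - 1) * T'" using assms(5) by blast
  \<comment> \<open>Coprimality lets the two divisors \<open>p - 1\<close> and \<open>p ^ N\<close>
    of \<open>T\<close> be split off together.\<close>
  have "coprime (p ^ N) (p - 1)"
    using p2 coprime_diff_one_right_nat[of p] by simp
  then have "p ^ N dvd T'" using \<open>p ^ N dvd T\<close> unfolding T' by (simp add: coprime_dvd_mult_right_iff)
  then obtain t where T: "T = (p - 1) * (p ^ N * t)" using T' by blast
  note shift = MZC_shift[OF assms(2-4) N T]
  have "(int p - 1) * padic_val p (fact k * of_nat (Stirling (T + B) k)) = int k - int (\<sigma> B)"
    using padic_val_fact_mult_Stirling[OF shift(1)] shift(2) by simp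
  then have "AMZC p (T + B) k"
    using shift(1,3) assms(2,3) by (intro AMZC_I) auto
  moreover have "rat_of_int ((int p - 1) * int (multiplicity p (Stirling (T + B) k))) =
      rat_of_int (int (\<sigma> k) - int (\<sigma> B))"
    by (simp only: shift(2))
  then have "rat_of_nat (multiplicity p (Stirling (T + B) k)) =
      (rat_of_nat (digit_sum p k) - rat_of_nat (digit_sum p B)) / (rat_of_nat p - 1)"
    using p2 by (simp add: field_simps)
  ultimately show ?thesis ..
qed

end
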